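(* Let $k\geq 2$ and $m\geq 1$ be integers, and let $\mathbf{A}\in\mathbb{C}^{km\times km}$ be a Hermitian matrix with $\mathbf{0}\preceq\mathbf{A}\preceq\mathbf{I}_{km}$. Set \[ \varepsilon:=\max_{1\leq i\leq m}\sum_{j=1}^k\mathbf{A}(i+(j-1)m,\,i+(j-1)m). \] If $\varepsilon\leq\frac{(k-1)^2}{k}$, then \[ \operatorname{maxroot}\ \psi_{k,m}[\mathbf{A}]\leq\frac{1}{k}\left(\sqrt{1-\frac{\varepsilon}{k-1}}+\sqrt{\varepsilon}\right)^2. \]
   Context: $\mathbf{A}(p,q)$ denotes the $(p,q)$ entry. Let $[m]=\{1,\ldots,m\}$. $\mathcal{P}_k(m)$ denotes the set of $k$-tuples $\mathcal{S}=(S_1,\ldots,S_k)$ of pairwise disjoint (possibly empty) subsets of $[m]$ with union $[m]$. $\mathbf{A}(\mathcal{S})$ is the principal submatrix of $\mathbf{A}$ with rows and columns indexed by $S_1\cup(m+S_2)\cup\cdots\cup((k-1)m+S_k)$. The $(k,m)$-characteristic polynomial is $\psi_{k,m}[\mathbf{A}](x):=\frac{1}{k^m}\sum_{\mathcal{S}\in\mathcal{P}_k(m)}\det[x\mathbf{I}_m-\mathbf{A}(\mathcal{S})]$; for Hermitian $\mathbf{A}$ it is real-rooted and $\operatorname{maxroot}$ denotes its largest root. *)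

theory Defs
  imports
    "Jordan_Normal_Form.Schur_Decomposition"
    "Jordan_Normal_Form.DL_Submatrix"
    "HOL-Library.Disjoint_Sets"
    "HOL-Library.FuncSet"
begin

text \<open>
  Matrix indices start at 0, so the set \<open>[m]\<close> is rendered as \<open>{..<m}\<close> and the blocks of a
  \<open>km \<times> km\<close> matrix are numbered by \<open>j < k\<close>; the \<open>i\<close>-th index of block \<open>j\<close> is \<open>i + j * m\<close>.
\<close>

definition hermitian_mat :: "complex mat \<Rightarrow> bool" where
  "hermitian_mat A \<longleftrightarrow> square_mat A \<and> mat_adjoint A = A"

text \<open>
  The order on \<^typ>\<open>complex\<close> is the one of \<^theory>\<open>HOL-Library.Complex_Order\<close>: \<open>0 \<le> z\<close> says that
  \<open>z\<close> is real and nonnegative.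
\<close>

definition psd_mat :: "complex mat \<Rightarrow> bool" where
  "psd_mat A \<longleftrightarrow> hermitian_mat A \<and> (\<forall>v \<in> carrier_vec (dim_row A). 0 \<le> (A *\<^sub>v v) \<bullet>c v)"

definition loewner_le :: "complex mat \<Rightarrow> complex mat \<Rightarrow> bool" (infix "\<preceq>\<^sub>L" 50) where
  "A \<preceq>\<^sub>L B \<longleftrightarrow> dim_row A = dim_row B \<and> dim_col A = dim_col B \<and> psd_mat (B - A)"

text \<open>
  A \<open>k\<close>-tuple of sets is a function on \<open>{..<k}\<close>, extensional so that distinct functions are
  distinct tuples.
\<close>

definition ordered_partitions :: "nat \<Rightarrow> nat \<Rightarrow> (nat \<Rightarrow> nat set) set" where
  "ordered_partitions k m =
    {S \<in> {..<k} \<rightarrow>\<^sub>E Pow {..<m}. disjoint_family_on S {..<k} \<and> (\<Union>j<k. S j) = {..<m}}"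

definition shifted_union :: "nat \<Rightarrow> nat \<Rightarrow> (nat \<Rightarrow> nat set) \<Rightarrow> nat set" where
  "shifted_union k m S = (\<Union>j<k. (\<lambda>i. i + j * m) ` S j)"

definition partition_submatrix :: "nat \<Rightarrow> nat \<Rightarrow> 'a mat \<Rightarrow> (nat \<Rightarrow> nat set) \<Rightarrow> 'a mat" where
  "partition_submatrix k m A S = submatrix A (shifted_union k m S) (shifted_union k m S)"

definition km_char_poly :: "nat \<Rightarrow> nat \<Rightarrow> complex mat \<Rightarrow> complex poly" where
  "km_char_poly k m A =
    smult (1 / of_nat k ^ m) (\<Sum>S \<in> ordered_partitions k m. char_poly (partition_submatrix k m A S))"

text \<open>Only meaningful for nonzero polynomials with at least one real root.\<close>

definition maxroot :: "complex poly \<Rightarrow> real" where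
  "maxroot p = Max {x. poly p (complex_of_real x) = 0}"

end

(*
Substituting y = 1/x turns the polynomial into x^m f_m(1/x, ..., 1/x), where
f_0(y) = det(I - diag(y) A), each y_i being repeated on the k rows of its block, and f_(s+1)
arises from f_s by truncating it in the s-th variable: c_0 + c_1 y + ... + c_k y^k becomes
c_0 + c_1 y / k. Every f_s is real stable. Fix real values below the zeros for the other
variables. As a function of y_i, f_s is then C * prod (1 - a_l y_i) with a_l >= 0, and the barrier
- d_j f_s / f_s is a constant plus a sum of r_l y_i / (1 - a_l y_i) with r_l >= 0. Such an expansion
shows that truncating in y_i while moving y_i from beta to tau does not increase the barriers of
the other variables as soon as k / tau >= 1 / beta + (sum of all a_l but the smallest). The
barrier in y_i itself bounds this sum by convexity. Since 0 <= A <= I, all barriers of f_0 at the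
point (beta, ..., beta) are at most epsilon / (1 - beta), so after m steps f_m has no zero below
(tau, ..., tau), i.e. all roots are at most 1 / tau. The best beta gives the bound.
*)
theory Submission
  imports Defs
begin

section \<open>Polynomials split into reciprocal roots\<close>

text \<open>In the coordinate y = 1/x every function is nonzero at 0. Normalising there yields
  exactly k factors 1 - a_l y whatever the degree, a missing root being a_l = 0. The division by k
  in the truncation is an average: the determinant is affine in each row weight, so switching on one
  of the k rows of a block, uniformly at random, gives c_0 + c_1 y / k. The r_l are nonnegative
  because the barrier, as a function of y_i, maps the upper half-plane into its closure, which
  forces simple poles with coefficients of one sign. Truncation keeps the constant and all r_l and
  only replaces each \<beta> / (1 - a_l \<beta>) by the common value \<tau> / (k - \<tau> sum a_l),
  so barriers are compared term by term. The hypothesis \<epsilon> \<le> (k-1)^2 / k places the best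
  \<beta> in the range up to 1, where the zeros of f_0 are under control; the value 1 itself is only
  reached as a limit.\<close>

lemma poly_prod_reciprocal:
  "poly (\<Prod>l\<in>I. [:1, - a l:]) x = (\<Prod>l\<in>I. 1 - a l * (x::'a::comm_ring_1))"
  by (simp add: poly_prod mult.commute)

lemma coeff_prod_reciprocal:
  assumes "finite I"
  shows "coeff (\<Prod>l\<in>I. [:1, - a l::'a::comm_ring_1:]) 0 = 1"
    and "coeff (\<Prod>l\<in>I. [:1, - a l::'a:]) (Suc 0) = - (\<Sum>l\<in>I. a l)"
  using assms by (induction I) (auto simp: coeff_mult)

text \<open>Peeling off a root z as the factor 1 - y/z requires z to be nonzero, hence
  \<open>poly q 0 \<noteq> 0\<close>. A degree below \<open>k\<close> is padded with factors where
  \<open>a l = 0\<close>, so every later product runs over all of \<open>{..<k}\<close>.\<close>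

lemma reciprocal_root_factorization:
  fixes q :: "complex poly"
  assumes "degree q \<le> k" "poly q 0 \<noteq> 0"
  shows "\<exists>a. q = smult (poly q 0) (\<Prod>l<k. [:1, - a l:])"
  using assms
proof (induction k arbitrary: q)
  case 0
  then obtain c where "q = [:c:]" by (metis degree_eq_zeroE le_zero_eq)
  then show ?case by auto
next
  case (Suc k)
  show ?case
  proof (cases "degree q = 0")
    case True
    then obtain c where "q = [:c:]" by (metis degree_eq_zeroE)
    then show ?thesis by (intro exI[of _ "\<lambda>_. 0"]) (auto simp: one_pCons[symmetric])
  next
    case False
    then obtain z where z: "poly q z = 0"
      using fundamental_theorem_of_algebra[of q] constant_degree[of q] by auto
    then obtain p where p: "q = [:-z, 1:] * p" by (metis dvdE poly_eq_0_iff_dvd)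
    have z0: "z \<noteq> 0" using z Suc.prems by auto
    define p' where "p' = smult (-z) p"
    have q: "q = [:1, - (1 / z):] * p'" using z0 by (simp add: p p'_def algebra_simps)
    have "p' \<noteq> 0" using q False by auto
    then have "degree q = Suc (degree p')" unfolding q using z0 by (subst degree_mult_eq) auto
    then have "degree p' \<le> k" using Suc.prems by simp
    moreover have p0: "poly p' 0 = poly q 0" by (simp add: q)
    ultimately obtain a where a: "p' = smult (poly q 0) (\<Prod>l<k. [:1, - a l:])"
      using Suc.IH[of p'] Suc.prems by auto
    have "q = smult (poly q 0) (\<Prod>l<Suc k. [:1, - (a(k := 1 / z)) l:])"
      using z0 by (subst q, subst a) (simp add: mult.commute)
    then show ?thesis by blast
  qed
qed

text \<open>The basis \<open>L\<close> is fixed before \<open>q\<close>, so coefficients become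
  linear functionals of the values at 0, ..., \<open>k\<close>. \<open>bivariate_sections\<close>
  applies this to a whole family of polynomials at once.\<close>

lemma Lagrange_basis:
  "\<exists>L. \<forall>q::'a::{field_char_0} poly. degree q \<le> k \<longrightarrow> q = (\<Sum>s\<le>k. smult (poly q (of_nat s)) (L s))"
proof -
  define L :: "nat \<Rightarrow> 'a poly" where
    "L s = (\<Prod>r\<in>{..k}-{s}. smult (1 / (of_nat s - of_nat r)) [:- of_nat r, 1:])" for s
  have L: "poly (L s) (of_nat t) = (if s = t then 1 else 0)" if "s \<le> k" "t \<le> k" for s t
    using that unfolding L_def poly_prod by (auto intro!: prod.neutral simp: divide_simps)
  have dL: "degree (L s) \<le> k" if "s \<le> k" for s
  proof -
    have "degree (L s) \<le> (\<Sum>r\<in>{..k}-{s}. degree (smult (1 / (of_nat s - of_nat r::'a)) [:- of_nat r, 1:]))"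
      unfolding L_def
      using degree_prod_sum_le[of "{..k}-{s}" "\<lambda>r. smult (1 / (of_nat s - of_nat r::'a)) [:- of_nat r, 1:]"]
      by (simp add: o_def)
    also have "\<dots> \<le> (\<Sum>r\<in>{..k}-{s}. 1)" by (intro sum_mono) simp
    finally show ?thesis using that by simp
  qed
  have "q = (\<Sum>s\<le>k. smult (poly q (of_nat s)) (L s))" if q: "degree q \<le> k" for q
  proof (rule poly_eqI_degree[where A = "of_nat ` {..k}"])
    show "degree q < card (of_nat ` {..k} :: 'a set)"
      using q by (subst card_image) (auto simp: inj_on_def)
    have "degree (\<Sum>s\<le>k. smult (poly q (of_nat s)) (L s)) \<le> k"
      by (intro degree_sum_le) (auto dest: dL)
    then show "degree (\<Sum>s\<le>k. smult (poly q (of_nat s)) (L s)) < card (of_nat ` {..k} :: 'a set)"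
      by (subst card_image) (auto simp: inj_on_def)
    fix x :: 'a assume "x \<in> of_nat ` {..k}"
    then obtain t where t: "x = of_nat t" "t \<le> k" by auto
    have "poly (\<Sum>s\<le>k. smult (poly q (of_nat s)) (L s)) x = (\<Sum>s\<le>k. if s = t then poly q (of_nat s) else 0)"
      unfolding poly_sum poly_smult t using t by (intro sum.cong refl) (simp add: L)
    then show "poly q x = poly (\<Sum>s\<le>k. smult (poly q (of_nat s)) (L s)) x"
      using t by simp
  qed
  then show ?thesis by blast
qed

section \<open>Partial fractions of rational functions with nonnegative imaginary part\<close>

lemma monic_prod_linear:
  assumes "finite I"
  shows "degree (\<Prod>l\<in>I. [:- a l, 1::'a::idom:]) = card I"
    and "coeff (\<Prod>l\<in>I. [:- a l, 1::'a:]) (card I) = 1"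
proof -
  show d: "degree (\<Prod>l\<in>I. [:- a l, 1::'a:]) = card I"
    by (subst degree_prod_eq_sum_degree) auto
  have "monic (\<Prod>l\<in>I. [:- a l, 1::'a:])" by (intro monic_prod) auto
  then show "coeff (\<Prod>l\<in>I. [:- a l, 1::'a:]) (card I) = 1" using d by simp
qed

lemma Im_of_real_times: "Im (of_real c * z) = c * Im z"
  by simp

text \<open>
  Letting \<open>x\<close> tend to a pole of order \<open>n\<close> along a direction \<open>v\<close>, the sign condition becomes
  \<open>0 \<le> Im (c / v ^ n)\<close>; for \<open>n \<ge> 2\<close> the powers \<open>v ^ n\<close> cover too many directions.
\<close>

lemma pole_lower_half_plane:
  fixes a :: "nat \<Rightarrow> real" and h :: "complex poly"
  assumes "finite I" and l: "l \<in> I"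
    and nonneg: "\<And>x. Im x < 0 \<Longrightarrow> 0 \<le> Im (poly h x / (\<Prod>i\<in>I. x - of_real (a i)))"
    and h: "poly h (of_real (a l)) \<noteq> 0"
  defines "c \<equiv> poly h (of_real (a l)) / (\<Prod>i\<in>{i\<in>I. a i \<noteq> a l}. of_real (a l) - of_real (a i))"
  shows "\<forall>i\<in>I. a i = a l \<longrightarrow> i = l" "Im c = 0" "0 \<le> Re c"
proof -
  define n where "n = card {i\<in>I. a i = a l}"
  define P where "P x = (\<Prod>i\<in>{i\<in>I. a i \<noteq> a l}. x - of_real (a i))" for x :: complex
  have split: "(\<Prod>i\<in>I. x - of_real (a i)) = (x - of_real (a l)) ^ n * P x" for x :: complex
  proof -
    have I: "I = {i\<in>I. a i = a l} \<union> {i\<in>I. a i \<noteq> a l}" by auto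
    have "(\<Prod>i\<in>I. x - of_real (a i)) = (\<Prod>i\<in>{i\<in>I. a i = a l}. x - of_real (a i)) * P x"
      unfolding P_def by (subst I, rule prod.union_disjoint) (use \<open>finite I\<close> in auto)
    also have "(\<Prod>i\<in>{i\<in>I. a i = a l}. x - of_real (a i)) = (x - of_real (a l)) ^ n"
      unfolding n_def by simp
    finally show ?thesis .
  qed
  have Pl: "P (of_real (a l)) \<noteq> 0" using \<open>finite I\<close> by (auto simp: P_def)
  have c: "c = poly h (of_real (a l)) / P (of_real (a l))" by (simp add: c_def P_def)
  have c0: "c \<noteq> 0" using h Pl by (simp add: c)
  have dir: "0 \<le> Im (c / v ^ n)" if v: "Im v < 0" for v
  proof -
    have v0: "v \<noteq> 0" using v by auto
    define G where "G s = Im (poly h (of_real (a l) + of_real s * v) / (v ^ n * P (of_real (a l) + of_real s * v)))" for s :: real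
    have "(G \<longlongrightarrow> Im (poly h (of_real (a l) + of_real 0 * v) / (v ^ n * P (of_real (a l) + of_real 0 * v)))) (at_right 0)"
      unfolding G_def P_def
      by (intro tendsto_intros isCont_tendsto_compose[OF poly_isCont]) (use v0 \<open>finite I\<close> in auto)
    then have lim: "(G \<longlongrightarrow> Im (c / v ^ n)) (at_right 0)" by (simp add: c divide_divide_eq_left mult.commute)
    have "eventually (\<lambda>s. 0 \<le> G s) (at_right 0)"
    proof (rule eventually_mono[OF eventually_at_right_less])
      fix s :: real assume s: "0 < s"
      let ?x = "of_real (a l) + of_real s * v"
      have "0 \<le> Im (poly h ?x / (\<Prod>i\<in>I. ?x - of_real (a i)))"
        using s v by (intro nonneg) (simp add: mult_pos_neg)
      also have "poly h ?x / (\<Prod>i\<in>I. ?x - of_real (a i)) = of_real (1 / s ^ n) * (poly h ?x / (v ^ n * P ?x))"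
        unfolding split by (simp add: power_mult_distrib)
      also have "Im \<dots> = (1 / s ^ n) * G s"
        unfolding G_def by (rule Im_of_real_times)
      finally have "0 \<le> (1 / s ^ n) * G s" .
      moreover have "0 < 1 / s ^ n" using s by simp
      ultimately show "0 \<le> G s" using zero_le_mult_iff[of "1 / s ^ n" "G s"] by linarith
    qed
    then show ?thesis using lim tendsto_lowerbound trivial_limit_at_right_real by blast
  qed
  have "n \<ge> 1" unfolding n_def using l \<open>finite I\<close> by (auto simp: Suc_le_eq card_gt_0_iff)
  have "n = 1"
  proof (rule ccontr)
    assume "n \<noteq> 1"
    then have n: "n \<ge> 2" using \<open>n \<ge> 1\<close> by simp
    \<comment> \<open>The direction is \<open>cis (- (t / n))\<close>, whose \<open>n\<close>-th
      power is \<open>cis (- t)\<close>. For \<open>n \<ge> 2\<close> it stays in the lower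
      half-plane for all these \<open>t\<close>, so every nontrivial rotation of \<open>c\<close>
      has nonnegative imaginary part.\<close>
    have rot: "0 \<le> Re c * sin t + Im c * cos t" if t: "0 < t" "t < 2 * pi" for t
    proof -
      have "t / n < pi"
      proof -
        have "2 * pi \<le> n * pi" using n by simp
        then have "t < n * pi" using t by linarith
        then show ?thesis using n by (simp add: divide_simps mult.commute)
      qed
      then have "0 < sin (t / n)" using t n by (intro sin_gt_zero) auto
      then have "0 \<le> Im (c / cis (- (t / n)) ^ n)" by (intro dir) simp
      also have "cis (- (t / n)) ^ n = cis (- t)" using n by (simp add: DeMoivre)
      also have "c / cis (- t) = c * cis t" by (simp only: divide_inverse cis_inverse minus_minus)
      finally show ?thesis by simp
    qed
    \<comment> \<open>Four angles already pin \<open>c\<close> down to 0.\<close>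
    have "0 \<le> Re c" using rot[of "pi / 2"] by simp
    moreover have "Re c \<le> 0"
      using rot[of "3 * pi / 2"] sin_3over2_pi cos_3over2_pi by (simp add: mult.commute)
    moreover have "Im c \<le> 0" using rot[of "pi"] by simp
    moreover have "0 \<le> Re c + Im c"
      using rot[of "pi / 4"] by (simp add: sin_45 cos_45 distrib_right[symmetric] zero_le_mult_iff zero_le_divide_iff add_divide_distrib[symmetric])
    ultimately have "c = 0" by (simp add: complex_eq_iff)
    then show False using c0 by simp
  qed
  then obtain i0 where "{i\<in>I. a i = a l} = {i0}"
    unfolding n_def by (auto simp: card_1_singleton_iff)
  then have "i = i0" if "i \<in> I" "a i = a l" for i using that by blast
  then show "\<forall>i\<in>I. a i = a l \<longrightarrow> i = l" using l by auto
  \<comment> \<open>For a simple pole, the direction \<open>inverse w\<close> turns the division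
    into multiplication by an arbitrary point of the upper half-plane.\<close>
  have half: "0 \<le> Im (c * w)" if w: "0 < Im w" for w
  proof -
    have "Im (inverse w) < 0" using w by (simp add: divide_neg_pos sum_power2_gt_zero_iff)
    from dir[OF this] show ?thesis by (simp add: \<open>n = 1\<close> divide_inverse)
  qed
  show "0 \<le> Re c" using half[of \<i>] by simp
  show "Im c = 0"
  proof (rule ccontr)
    assume "Im c \<noteq> 0"
    \<comment> \<open>Chosen so that the imaginary part of the product is
      \<open>- (Re c + 1) + Re c = - 1\<close>.\<close>
    then show False using half[of "Complex (- (Re c + 1) / Im c) 1"] by simp
  qed
qed

text \<open>A common zero of numerator and denominator is cancelled, leaving one node less. Once
  \<open>h\<close> vanishes at no node, every node is a genuine pole, so
  \<open>pole_lower_half_plane\<close> makes the nodes distinct and the residues real and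
  nonnegative; the expansion then follows by interpolation at the nodes together with the top
  coefficient.\<close>

lemma partial_fractions_lower_half_plane:
  fixes a :: "nat \<Rightarrow> real" and h :: "complex poly"
  assumes "finite I" and "degree h \<le> card I"
    and "\<And>x. Im x < 0 \<Longrightarrow> 0 \<le> Im (poly h x / (\<Prod>i\<in>I. x - of_real (a i)))"
  shows "\<exists>b r. (\<forall>l\<in>I. 0 \<le> (r l :: real)) \<and>
    h = smult b (\<Prod>i\<in>I. [:- of_real (a i), 1:]) +
        (\<Sum>l\<in>I. smult (of_real (r l)) (\<Prod>i\<in>I-{l}. [:- of_real (a i), 1:]))"
  using assms
proof (induction I arbitrary: h rule: finite_psubset_induct)
  case (psubset I)
  show ?case
  proof (cases "\<exists>l\<in>I. poly h (of_real (a l)) = 0")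
    case True
    then obtain l where l: "l \<in> I" and "poly h (of_real (a l)) = 0" by blast
    then obtain p where p: "h = [:- of_real (a l), 1:] * p" by (metis dvdE poly_eq_0_iff_dvd)
    have card: "card I = Suc (card (I - {l}))" using l psubset.hyps card_Suc_Diff1 by metis
    have deg: "degree p \<le> card (I - {l})"
    proof (cases "p = 0")
      case False
      then have "degree h = Suc (degree p)" unfolding p by (subst degree_mult_eq) auto
      then show ?thesis using psubset.prems(1) card by simp
    qed simp
    have rem: "(\<Prod>i\<in>J. [:- complex_of_real (a i), 1:]) = [:- of_real (a l), 1:] * (\<Prod>i\<in>J - {l}. [:- of_real (a i), 1:])"
      if "l \<in> J" "J \<subseteq> I" for J
      by (rule prod.remove) (use that psubset.hyps finite_subset in auto)
    have "0 \<le> Im (poly p x / (\<Prod>i\<in>I - {l}. x - of_real (a i)))" if x: "Im x < 0" for x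
    proof -
      have "x \<noteq> of_real (a l)" using x by auto
      moreover have "(\<Prod>i\<in>I. x - of_real (a i)) = (x - of_real (a l)) * (\<Prod>i\<in>I - {l}. x - of_real (a i))"
        by (rule prod.remove) (use l psubset.hyps in auto)
      moreover have "poly h x = (x - of_real (a l)) * poly p x" by (simp add: p algebra_simps)
      ultimately have "poly h x / (\<Prod>i\<in>I. x - of_real (a i)) = poly p x / (\<Prod>i\<in>I - {l}. x - of_real (a i))"
        by simp
      then show ?thesis using psubset.prems(2)[OF x] by simp
    qed
    from psubset.IH[OF _ deg this] obtain b r where r: "\<forall>i\<in>I-{l}. 0 \<le> (r i :: real)" and
      eq: "p = smult b (\<Prod>i\<in>I - {l}. [:- of_real (a i), 1:]) +
        (\<Sum>j\<in>I - {l}. smult (of_real (r j)) (\<Prod>i\<in>I - {l} - {j}. [:- of_real (a i), 1:]))"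
      using l by blast
    \<comment> \<open>The cancelled node carries no pole.\<close>
    let ?r = "r(l := 0)"
    have "(\<Sum>j\<in>I. smult (of_real (?r j)) (\<Prod>i\<in>I-{j}. [:- complex_of_real (a i), 1:])) =
      (\<Sum>j\<in>I - {l}. smult (of_real (?r j)) (\<Prod>i\<in>I-{j}. [:- of_real (a i), 1:]))"
      by (rule sum.mono_neutral_right) (use psubset.hyps in auto)
    also have "\<dots> = (\<Sum>j\<in>I - {l}. [:- of_real (a l), 1:] * smult (of_real (r j)) (\<Prod>i\<in>I - {l} - {j}. [:- of_real (a i), 1:]))"
    proof (rule sum.cong[OF refl])
      fix j assume j: "j \<in> I - {l}"
      have "I - {j} - {l} = I - {l} - {j}" by auto
      then show "smult (of_real (?r j)) (\<Prod>i\<in>I-{j}. [:- complex_of_real (a i), 1:]) =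
        [:- of_real (a l), 1:] * smult (of_real (r j)) (\<Prod>i\<in>I - {l} - {j}. [:- of_real (a i), 1:])"
        using rem[of "I - {j}"] j l by (simp only: mult_smult_right) auto
    qed
    also have "\<dots> = [:- of_real (a l), 1:] * (\<Sum>j\<in>I - {l}. smult (of_real (r j)) (\<Prod>i\<in>I - {l} - {j}. [:- of_real (a i), 1:]))"
      by (simp only: sum_distrib_left)
    finally have s: "(\<Sum>j\<in>I. smult (of_real (?r j)) (\<Prod>i\<in>I-{j}. [:- complex_of_real (a i), 1:])) = \<dots>" .
    have "h = smult b (\<Prod>i\<in>I. [:- of_real (a i), 1:]) +
        (\<Sum>j\<in>I. smult (of_real (?r j)) (\<Prod>i\<in>I-{j}. [:- of_real (a i), 1:]))"
      unfolding s rem[OF l order_refl] p by (subst eq) (simp only: distrib_left mult_smult_right)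
    moreover have "\<forall>j\<in>I. 0 \<le> ?r j" using r by auto
    ultimately show ?thesis by blast
  next
    case False
    define c where "c l = poly h (of_real (a l)) / (\<Prod>i\<in>{i\<in>I. a i \<noteq> a l}. of_real (a l) - of_real (a i))" for l
    note pole = pole_lower_half_plane[OF psubset.hyps _ psubset.prems(2), folded c_def]
    have inj: "inj_on a I" using pole(1) False by (auto simp: inj_on_def)
    have c_real: "c l = of_real (Re (c l))" if "l \<in> I" for l
      using pole(2)[OF that] False that by (simp add: complex_eq_iff)
    have others: "{i\<in>I. a i \<noteq> a l} = I - {l}" if "l \<in> I" for l
      using inj that by (auto simp: inj_on_def)
    let ?b = "coeff h (card I)"
    let ?R = "smult ?b (\<Prod>i\<in>I. [:- of_real (a i), 1:]) +
        (\<Sum>l\<in>I. smult (of_real (Re (c l))) (\<Prod>i\<in>I-{l}. [:- of_real (a i), 1:]))"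
    have d1: "degree (\<Prod>i\<in>I-{l}. [:- complex_of_real (a i), 1:]) < card I" if "l \<in> I" for l
      using monic_prod_linear(1)[of "I - {l}" "\<lambda>i. complex_of_real (a i)"] psubset.hyps
        card_Diff1_less[OF psubset.hyps that] by simp
    have "h = ?R"
    proof (rule poly_eqI_degree_lead_coeff[where n = "card I" and A = "(\<lambda>l. complex_of_real (a l)) ` I"])
      show "coeff h (card I) = coeff ?R (card I)"
        using psubset.hyps d1 by (simp add: coeff_sum monic_prod_linear coeff_eq_0)
      have "card ((\<lambda>l. complex_of_real (a l)) ` I) = card I"
        using inj by (intro card_image) (auto simp: inj_on_def)
      then show "card I \<le> card ((\<lambda>l. complex_of_real (a l)) ` I)" by simp
      show "degree h \<le> card I" by fact
      show "degree ?R \<le> card I"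
      proof (intro degree_add_le degree_sum_le)
        show "degree (smult ?b (\<Prod>i\<in>I. [:- complex_of_real (a i), 1:])) \<le> card I"
          using monic_prod_linear(1)[OF psubset.hyps, of "\<lambda>i. complex_of_real (a i)"]
          by (simp add: degree_smult_eq)
        show "degree (smult (of_real (Re (c l))) (\<Prod>i\<in>I-{l}. [:- complex_of_real (a i), 1:])) \<le> card I"
          if "l \<in> I" for l using d1[OF that] by (simp add: degree_smult_eq)
      qed (use psubset.hyps in auto)
      fix z assume "z \<in> (\<lambda>l. complex_of_real (a l)) ` I"
      then obtain l where l: "l \<in> I" and z: "z = of_real (a l)" by auto
      have "poly ?R z = (\<Sum>j\<in>I. of_real (Re (c j)) * (\<Prod>i\<in>I-{j}. z - of_real (a i)))"
        using l psubset.hyps by (auto simp: poly_sum poly_prod z)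
      also have "\<dots> = (\<Sum>j\<in>I. if j = l then of_real (Re (c j)) * (\<Prod>i\<in>I-{j}. z - of_real (a i)) else 0)"
        using l psubset.hyps by (intro sum.cong) (auto simp: z)
      also have "\<dots> = c l * (\<Prod>i\<in>I-{l}. z - of_real (a i))"
        using l psubset.hyps c_real by simp
      also have "\<dots> = poly h z"
      proof -
        have "(\<Prod>i\<in>I-{l}. z - of_real (a i)) \<noteq> 0"
          using psubset.hyps inj l by (auto simp: z inj_on_def)
        then show ?thesis by (simp add: c_def others[OF l] z)
      qed
      finally show "poly h z = poly ?R z" by simp
    qed
    then show ?thesis
      using pole(3) False by (intro exI[of _ ?b] exI[of _ "\<lambda>l. Re (c l)"]) auto
  qed
qed

text \<open>The inversion of x to 1/x exchanges the half-planes and turns 1 - a x into x - a up to a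
  power of x. A factor with \<open>a i = 0\<close>, which stands for a pole at infinity, thereby
  becomes an ordinary node at 0.\<close>

lemma partial_fractions_upper_half_plane:
  fixes a :: "nat \<Rightarrow> real" and h :: "complex poly"
  assumes "finite I" and deg: "degree h \<le> card I"
    and nonneg: "\<And>x. 0 < Im x \<Longrightarrow> 0 \<le> Im (poly h x / (\<Prod>i\<in>I. 1 - of_real (a i) * x))"
  shows "\<exists>b r. (\<forall>l\<in>I. 0 \<le> (r l :: real)) \<and>
    h = smult b (\<Prod>i\<in>I. [:1, - of_real (a i):]) +
        (\<Sum>l\<in>I. smult (of_real (r l)) ([:0, 1:] * (\<Prod>i\<in>I-{l}. [:1, - of_real (a i):])))"
proof -
  \<comment> \<open>Reversed with respect to \<open>card I\<close> rather than the degree of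
    \<open>h\<close>, so that the powers of \<open>x\<close> in numerator and denominator
    cancel.\<close>
  define H where "H = (\<Sum>i\<le>card I. monom (coeff h i) (card I - i))"
  have H: "poly H x = x ^ card I * poly h (1 / x)" if "x \<noteq> 0" for x
  proof -
    have "poly h (1 / x) = (\<Sum>i\<le>card I. coeff h i * (1 / x) ^ i)"
      using arg_cong[OF poly_as_sum_of_monoms'[OF deg], of "\<lambda>p. poly p (1 / x)"]
      by (simp add: poly_sum poly_monom)
    moreover have "coeff h i * x ^ (card I - i) = x ^ card I * (coeff h i * (1 / x) ^ i)" if "i \<le> card I" for i
      using that \<open>x \<noteq> 0\<close> by (simp add: power_diff power_divide)
    ultimately show ?thesis
      unfolding H_def poly_sum poly_monom by (simp only: sum_distrib_left) (rule sum.cong, auto)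
  qed
  have prod: "(\<Prod>i\<in>J. x - of_real (a i)) = x ^ card J * (\<Prod>i\<in>J. 1 - of_real (a i) * (1 / x))"
    if "x \<noteq> 0" for x :: complex and J
  proof -
    have "(\<Prod>i\<in>J. x - of_real (a i)) = (\<Prod>i\<in>J. x * (1 - of_real (a i) * (1 / x)))"
      using that by (intro prod.cong) (auto simp: field_simps)
    then show ?thesis by (simp add: prod.distrib)
  qed
  have "degree H \<le> card I"
    unfolding H_def by (intro degree_sum_le) (auto intro: order_trans[OF degree_monom_le])
  moreover have "0 \<le> Im (poly H x / (\<Prod>i\<in>I. x - of_real (a i)))" if x: "Im x < 0" for x
  proof -
    have x0: "x \<noteq> 0" using x by auto
    have "0 < Im (1 / x)" using x by (simp add: Im_divide divide_neg_pos sum_power2_gt_zero_iff)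
    then have "0 \<le> Im (poly h (1 / x) / (\<Prod>i\<in>I. 1 - of_real (a i) * (1 / x)))" by (rule nonneg)
    then show ?thesis unfolding H[OF x0] prod[OF x0] using x0 by simp
  qed
  ultimately obtain b r where r: "\<forall>l\<in>I. 0 \<le> (r l :: real)" and
    eq: "H = smult b (\<Prod>i\<in>I. [:- of_real (a i), 1:]) +
        (\<Sum>l\<in>I. smult (of_real (r l)) (\<Prod>i\<in>I-{l}. [:- of_real (a i), 1:]))"
    using partial_fractions_lower_half_plane[OF \<open>finite I\<close>, of H a] by blast
  let ?R = "smult b (\<Prod>i\<in>I. [:1, - of_real (a i):]) +
        (\<Sum>l\<in>I. smult (of_real (r l)) ([:0, 1:] * (\<Prod>i\<in>I-{l}. [:1, - of_real (a i):])))"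
  have "poly h z = poly ?R z" if z: "z \<noteq> 0" for z
  proof -
    have z': "1 / z \<noteq> 0" using z by simp
    have "poly h z = z ^ card I * poly H (1 / z)"
      unfolding H[OF z'] using z by (simp add: power_divide)
    also have "poly H (1 / z) = b * (\<Prod>i\<in>I. 1 / z - of_real (a i)) +
        (\<Sum>l\<in>I. of_real (r l) * (\<Prod>i\<in>I-{l}. 1 / z - of_real (a i)))"
      by (simp add: eq poly_sum poly_prod)
    also have "z ^ card I * \<dots> = b * (\<Prod>i\<in>I. 1 - of_real (a i) * z) +
        (\<Sum>l\<in>I. z ^ card I * (of_real (r l) * (\<Prod>i\<in>I-{l}. 1 / z - of_real (a i))))"
      unfolding prod[OF z', of I] using z by (simp add: distrib_left sum_distrib_left power_divide)
    also have "(\<Sum>l\<in>I. z ^ card I * (of_real (r l) * (\<Prod>i\<in>I-{l}. 1 / z - of_real (a i)))) =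
      (\<Sum>l\<in>I. of_real (r l) * (z * (\<Prod>i\<in>I-{l}. 1 - of_real (a i) * z)))"
    proof (rule sum.cong[OF refl])
      fix l assume l: "l \<in> I"
      have "z ^ card I = z * z ^ card (I - {l})"
        using card_Suc_Diff1[OF \<open>finite I\<close> l] by (metis power_Suc)
      then show "z ^ card I * (of_real (r l) * (\<Prod>i\<in>I-{l}. 1 / z - of_real (a i))) =
        of_real (r l) * (z * (\<Prod>i\<in>I-{l}. 1 - of_real (a i) * z))"
        unfolding prod[OF z', of "I - {l}"] using z by (simp add: power_divide)
    qed
    finally show ?thesis by (simp add: poly_sum poly_prod mult.commute mult.left_commute)
  qed
  then have "{z. poly (h - ?R) z \<noteq> 0} \<subseteq> {0}" by auto
  then have "- {0} \<subseteq> {z. poly (h - ?R) z = 0}" by auto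
  moreover have "infinite (- {0 :: complex})" by (simp add: Compl_eq_Diff_UNIV infinite_UNIV_char_0)
  ultimately have "h - ?R = 0" using poly_roots_finite finite_subset by blast
  then have "h = ?R" by simp
  then show ?thesis using r by (intro exI[of _ b] exI[of _ r] conjI) 
qed

section \<open>Stable functions of several variables\<close>

text \<open>Only meaningful when \<open>f\<close> is a polynomial in the \<open>i\<close>-th coordinate.\<close>

definition section_poly :: "((nat \<Rightarrow> complex) \<Rightarrow> complex) \<Rightarrow> nat \<Rightarrow> (nat \<Rightarrow> complex) \<Rightarrow> complex poly" where
  "section_poly f i z = (THE q. \<forall>x. poly q x = f (z(i := x)))"

definition barrier :: "((nat \<Rightarrow> complex) \<Rightarrow> complex) \<Rightarrow> nat \<Rightarrow> (nat \<Rightarrow> complex) \<Rightarrow> complex" where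
  "barrier f j z = - poly (pderiv (section_poly f j z)) (z j) / f z"

lemma section_poly_eqI: "(\<And>x. poly q x = f (z(i := x))) \<Longrightarrow> section_poly f i z = q"
  unfolding section_poly_def
  by (rule the_equality) (auto simp: poly_eq_poly_eq_iff[symmetric] fun_eq_iff)

lemma section_poly_upd: "section_poly f i (z(i := w)) = section_poly f i z"
  by (simp add: section_poly_def)

text \<open>Stands in for polynomials in several variables: only one-variable sections, limits from
  the right and real coefficients (\<open>cnj_f\<close>) are recorded. The number \<open>k\<close>
  bounds the degree in each variable separately.\<close>

locale separately_poly =
  fixes k :: nat and f :: "(nat \<Rightarrow> complex) \<Rightarrow> complex"
  assumes k_pos: "0 < k"
    and ex_section: "\<exists>q. degree q \<le> k \<and> (\<forall>x. poly q x = f (z(i := x)))"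
    and tends: "(\<And>r. ((\<lambda>t. g t r) \<longlongrightarrow> l r) (at_right (0::real))) \<Longrightarrow> ((\<lambda>t. f (g t)) \<longlongrightarrow> f l) (at_right 0)"
    and cnj_f: "f (\<lambda>r. cnj (z r)) = cnj (f z)"
begin

lemma section_poly: "poly (section_poly f i z) x = f (z(i := x))" "degree (section_poly f i z) \<le> k"
  using ex_section[of z i] section_poly_eqI[of _ f z i] by auto

text \<open>Interpolation in coordinate \<open>i\<close> at 0, ..., \<open>k\<close> expresses each
  \<open>c l\<close> as a fixed combination of sections in coordinate \<open>j\<close>. So the
  coefficients in \<open>i\<close> are polynomials in \<open>j\<close> and can be differentiated in
  \<open>j\<close>.\<close>

lemma bivariate_sections:
  assumes "i \<noteq> j"
  obtains c where "\<And>x. section_poly f j (z(i := x)) = (\<Sum>l\<le>k. smult (x ^ l) (c l))"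
    and "\<And>w. section_poly f i (z(j := w)) = (\<Sum>l\<le>k. monom (poly (c l) w) l)"
proof -
  obtain L :: "nat \<Rightarrow> complex poly" where L: "\<And>q. degree q \<le> k \<Longrightarrow> q = (\<Sum>s\<le>k. smult (poly q (of_nat s)) (L s))"
    using Lagrange_basis[of k, where 'a = complex] by blast
  define c where "c l = (\<Sum>s\<le>k. smult (coeff (L s) l) (section_poly f j (z(i := of_nat s))))" for l
  have sec: "section_poly f i (z(j := w)) = (\<Sum>l\<le>k. monom (poly (c l) w) l)" for w
  proof -
    let ?q = "section_poly f i (z(j := w))"
    have "coeff ?q l = poly (c l) w" for l
      unfolding c_def poly_sum poly_smult section_poly
      using arg_cong[OF L[OF section_poly(2)[of i "z(j := w)"]], of "\<lambda>p. coeff p l"] assms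
      by (simp add: coeff_sum section_poly fun_upd_twist mult.commute)
    then show ?thesis
      using poly_as_sum_of_monoms'[OF section_poly(2)[of i "z(j := w)"]] by simp
  qed
  moreover have "section_poly f j (z(i := x)) = (\<Sum>l\<le>k. smult (x ^ l) (c l))" for x
  proof (rule section_poly_eqI)
    fix w
    have "f (z(i := x, j := w)) = poly (section_poly f i (z(j := w))) x"
      using assms by (simp add: section_poly fun_upd_twist)
    then show "poly (\<Sum>l\<le>k. smult (x ^ l) (c l)) w = f (z(i := x, j := w))"
      by (simp add: sec poly_sum poly_monom mult.commute)
  qed
  ultimately show thesis using that by blast
qed

end

text \<open>Nonvanishing is required also where some coordinates are 0, so that
  \<open>z(i := 0)\<close> is an admissible base point for the reciprocal factorisation.
  \<open>nonzero\<close> says that the real point \<open>B\<close> lies below the zero set: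
  everything under it, negative coordinates included, is free of zeros.\<close>

locale stable_poly = separately_poly +
  fixes B :: "nat \<Rightarrow> real"
  assumes stable: "(\<And>r. 0 < Im (z r) \<or> z r = 0) \<Longrightarrow> f z \<noteq> 0"
    and B_pos: "0 < B r"
    and nonzero: "(\<And>r. u r \<le> B r) \<Longrightarrow> f (\<lambda>r. of_real (u r)) \<noteq> 0"
begin

text \<open>Inversion maps the lower half-plane to the upper one, so a reciprocal root with negative
  imaginary part would be a forbidden zero.\<close>

lemma stable_factorization:
  assumes "\<And>r. r \<noteq> i \<Longrightarrow> 0 < Im (z r) \<or> z r = 0"
  obtains a where "\<And>l. l < k \<Longrightarrow> 0 \<le> Im (a l)" "f (z(i := 0)) \<noteq> 0"
    and "section_poly f i z = smult (f (z(i := 0))) (\<Prod>l<k. [:1, - a l:])"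
proof -
  have 0: "f (z(i := 0)) \<noteq> 0" using assms by (intro stable) auto
  then obtain a where a: "section_poly f i z = smult (f (z(i := 0))) (\<Prod>l<k. [:1, - a l:])"
    using reciprocal_root_factorization[OF section_poly(2)[of i z]] by (auto simp: section_poly)
  have "0 \<le> Im (a l)" if l: "l < k" for l
  proof (rule ccontr)
    assume neg: "\<not> 0 \<le> Im (a l)"
    then have "a l \<noteq> 0" by auto
    then have "poly (section_poly f i z) (1 / a l) = 0"
      unfolding a poly_smult poly_prod_reciprocal using l by auto
    then have "f (z(i := 1 / a l)) = 0" by (simp add: section_poly)
    moreover have "0 < Im (1 / a l)"
      using neg by (simp add: Im_divide divide_neg_pos sum_power2_gt_zero_iff)
    then have "f (z(i := 1 / a l)) \<noteq> 0" using assms by (intro stable) auto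
    ultimately show False by simp
  qed
  then show thesis using that a 0 by blast
qed

text \<open>This quantitative form of stability survives limits, and so replaces Hurwitz' theorem.\<close>

lemma stable_lower_bound:
  assumes z: "\<And>r. r \<noteq> i \<Longrightarrow> 0 < Im (z r) \<or> z r = 0" and x: "0 < Im x"
  shows "norm (f (z(i := 0))) * (Im x / norm x) ^ k \<le> norm (f (z(i := x)))"
proof -
  obtain a where a: "\<And>l. l < k \<Longrightarrow> 0 \<le> Im (a l)"
    and eq: "section_poly f i z = smult (f (z(i := 0))) (\<Prod>l<k. [:1, - a l:])"
    using stable_factorization[of i z, OF z] by blast
  have x0: "x \<noteq> 0" using x by auto
  have "Im x / norm x \<le> norm (1 - a l * x)" if l: "l < k" for l
  proof -
    \<comment> \<open>After factoring out \<open>x\<close>, the number \<open>1 / x\<close> lies in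
      the open lower half-plane and \<open>a l\<close> does not, so the imaginary parts of the
      difference add up instead of cancelling.\<close>
    have "Im x / (norm x)\<^sup>2 \<le> - Im (1 / x - a l)"
      using a[OF l] by (simp add: Im_divide cmod_power2)
    also have "\<dots> \<le> norm (1 / x - a l)" using abs_Im_le_cmod[of "1 / x - a l"] by linarith
    finally have "norm x * (Im x / (norm x)\<^sup>2) \<le> norm x * norm (1 / x - a l)"
      by (intro mult_left_mono) auto
    also have "\<dots> = norm (1 - a l * x)"
      using x0 by (simp add: norm_mult[symmetric] algebra_simps)
    finally show ?thesis using x0 by (simp add: power2_eq_square)
  qed
  then have "(\<Prod>l<k. Im x / norm x) \<le> (\<Prod>l<k. norm (1 - a l * x))"
    using x by (intro prod_mono) auto
  then have "(Im x / norm x) ^ k \<le> norm (\<Prod>l<k. 1 - a l * x)"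
    by (simp add: prod_norm)
  moreover have "f (z(i := x)) = f (z(i := 0)) * (\<Prod>l<k. 1 - a l * x)"
    unfolding section_poly(1)[symmetric, of z i x] eq by (simp add: poly_prod_reciprocal)
  ultimately show ?thesis by (simp add: norm_mult mult_left_mono)
qed

text \<open>Real coordinates are raised to \<open>u r + \<i> * t\<close>, where the point is stable.
  \<open>stable_lower_bound\<close>, used in \<open>i\<close> and in \<open>j\<close>, bounds
  \<open>f\<close> from below by a fixed multiple of its value with both coordinates at 0, uniformly
  in \<open>t\<close>. In the limit that value is nonzero because 0 lies below
  \<open>B\<close>.\<close>

lemma nonzero_mixed:
  assumes u: "\<And>r. u r \<le> B r" and x: "0 < Im x" and w: "0 < Im w"
  shows "f ((\<lambda>r. of_real (u r))(i := x, j := w)) \<noteq> 0"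
proof -
  define G where "G y v t = (\<lambda>r. of_real (u r) + \<i> * of_real t)(i := y, j := v)" for y v :: complex and t :: real
  have lim: "((\<lambda>t. f (G y v t)) \<longlongrightarrow> f ((\<lambda>r. of_real (u r))(i := y, j := v))) (at_right 0)" for y v
  proof (rule tends)
    fix r
    have "((\<lambda>t. of_real (u r) + \<i> * of_real t) \<longlongrightarrow> of_real (u r) + \<i> * of_real 0) (at_right 0)"
      by (intro tendsto_intros)
    then show "((\<lambda>t. G y v t r) \<longlongrightarrow> ((\<lambda>r. of_real (u r))(i := y, j := v)) r) (at_right 0)"
      unfolding G_def by (cases "r = j"; cases "r = i") auto
  qed
  define d where "d = (if i = j then 1 else (Im x / norm x) ^ k) * (Im w / norm w) ^ k"
  have "norm w > 0" "norm x > 0" using x w by auto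
  then have "0 < d" using x w unfolding d_def by auto
  have "eventually (\<lambda>t. norm (f (G 0 0 t)) * d \<le> norm (f (G x w t))) (at_right 0)"
  proof (rule eventually_mono[OF eventually_at_right_less])
    fix t :: real assume t: "0 < t"
    have 1: "norm (f (G x 0 t)) * (Im w / norm w) ^ k \<le> norm (f (G x w t))"
      using stable_lower_bound[of j "G x 0 t" w] x w t by (auto simp: G_def)
    have 2: "norm (f (G 0 0 t)) * (if i = j then 1 else (Im x / norm x) ^ k) \<le> norm (f (G x 0 t))"
    proof (cases "i = j")
      case False
      then have "(G 0 0 t)(i := x) = G x 0 t" "(G 0 0 t)(i := 0) = G 0 0 t"
        by (auto simp: G_def fun_eq_iff)
      then show ?thesis using stable_lower_bound[of i "G 0 0 t" x] x t False by (auto simp: G_def)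
    qed (simp add: G_def)
    have "norm (f (G 0 0 t)) * d \<le> norm (f (G x 0 t)) * (Im w / norm w) ^ k"
      unfolding d_def mult.assoc[symmetric] using w by (intro mult_right_mono[OF 2]) auto
    then show "norm (f (G 0 0 t)) * d \<le> norm (f (G x w t))" using 1 by linarith
  qed
  then have "norm (f ((\<lambda>r. of_real (u r))(i := 0, j := 0))) * d \<le> norm (f ((\<lambda>r. of_real (u r))(i := x, j := w)))"
    by (intro tendsto_le[OF trivial_limit_at_right_real tendsto_norm[OF lim] tendsto_mult_right[OF tendsto_norm[OF lim]]])
  moreover have "f ((\<lambda>r. of_real (u r))(i := 0, j := 0)) \<noteq> 0"
  proof -
    have "(\<lambda>r. complex_of_real (u r))(i := 0, j := 0) = (\<lambda>r. of_real ((u(i := 0, j := 0)) r))" by auto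
    then show ?thesis using nonzero[of "u(i := 0, j := 0)"] u B_pos by (simp add: less_imp_le)
  qed
  ultimately show ?thesis using \<open>0 < d\<close> by (auto simp: mult_le_0_iff)
qed

lemma nonzero_mixed_single:
  assumes u: "\<And>r. u r \<le> B r" and x: "0 < Im x"
  shows "f ((\<lambda>r. of_real (u r))(i := x)) \<noteq> 0"
  using nonzero_mixed[OF u x x, of i i] by simp

text \<open>Conjugation symmetry moves a nonreal root into the upper half-plane, which
  \<open>nonzero_mixed_single\<close> excludes; a real root lies beyond \<open>B i\<close>, which is
  positive.\<close>

lemma real_factorization:
  assumes u: "\<And>r. u r \<le> B r"
  obtains a where "\<And>l. l < k \<Longrightarrow> 0 \<le> a l \<and> a l * B i < 1"
    and "f ((\<lambda>r. of_real (u r))(i := 0)) \<noteq> 0"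
    and "section_poly f i (\<lambda>r. of_real (u r)) =
      smult (f ((\<lambda>r. of_real (u r))(i := 0))) (\<Prod>l<k. [:1, - of_real (a l):])"
proof -
  let ?U = "\<lambda>r. complex_of_real (u r)"
  have real: "f (?U(i := of_real x)) \<noteq> 0" if "x \<le> B i" for x
  proof -
    have "?U(i := of_real x) = (\<lambda>r. of_real ((u(i := x)) r))" by auto
    then show ?thesis using nonzero[of "u(i := x)"] u that by simp
  qed
  have 0: "f (?U(i := 0)) \<noteq> 0" using real[of 0] B_pos[of i] by simp
  then obtain a where a: "section_poly f i ?U = smult (f (?U(i := 0))) (\<Prod>l<k. [:1, - a l:])"
    using reciprocal_root_factorization[OF section_poly(2)[of i ?U]] by (auto simp: section_poly)
  have root: "f (?U(i := 1 / a l)) = 0" if "l < k" "a l \<noteq> 0" for l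
  proof -
    have "poly (section_poly f i ?U) (1 / a l) = 0"
      unfolding a poly_smult poly_prod_reciprocal using that by auto
    then show ?thesis by (simp add: section_poly)
  qed
  have Im0: "Im (a l) = 0" if l: "l < k" for l
  proof (rule ccontr)
    assume im: "Im (a l) \<noteq> 0"
    then have "a l \<noteq> 0" by auto
    note r = root[OF l this]
    have "?U(i := cnj (1 / a l)) = (\<lambda>r. cnj ((?U(i := 1 / a l)) r))" by auto
    then have r': "f (?U(i := cnj (1 / a l))) = 0" using cnj_f[of "?U(i := 1 / a l)"] r by simp
    show False
    proof (cases "Im (a l) < 0")
      case True
      then have "0 < Im (1 / a l)" by (simp add: Im_divide divide_neg_pos sum_power2_gt_zero_iff)
      then show False using nonzero_mixed_single[OF u, of "1 / a l" i] r by simp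
    next
      case False
      then have "0 < Im (cnj (1 / a l))"
        using im by (simp add: Im_divide sum_power2_gt_zero_iff)
      then show False using nonzero_mixed_single[OF u, of "cnj (1 / a l)" i] r' by simp
    qed
  qed
  have a_real: "a l = of_real (Re (a l))" if "l < k" for l
    using Im0[OF that] by (simp add: complex_eq_iff)
  have bounds: "0 \<le> Re (a l) \<and> Re (a l) * B i < 1" if l: "l < k" for l
  proof (rule ccontr)
    assume neg: "\<not> (0 \<le> Re (a l) \<and> Re (a l) * B i < 1)"
    then have nz: "Re (a l) \<noteq> 0" by auto
    have "1 / Re (a l) \<le> B i"
    proof (cases "Re (a l) < 0")
      case True
      then have "1 / Re (a l) \<le> 0" by simp
      then show ?thesis using B_pos[of i] by linarith
    next
      case False
      then show ?thesis using neg nz by (simp add: divide_simps mult.commute)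
    qed
    then have "f (?U(i := of_real (1 / Re (a l)))) \<noteq> 0" by (rule real)
    moreover have "of_real (1 / Re (a l)) = 1 / a l" by (subst (2) a_real[OF l]) simp
    moreover have "a l \<noteq> 0" using nz by auto
    ultimately show False using root[OF l] by metis
  qed
  have "(\<Prod>l<k. [:1, - of_real (Re (a l)):]) = (\<Prod>l<k. [:1, - a l:])"
    by (intro prod.cong refl) (simp add: a_real[symmetric])
  then show thesis using that[of "\<lambda>l. Re (a l)"] bounds 0 a by simp
qed

text \<open>Recentred at \<open>u j\<close>, the section in \<open>j\<close> has no root in the
  upper half-plane, so its reciprocal roots have nonnegative imaginary part; the barrier is their
  sum. With \<open>x\<close> varying, this is the half-plane property that
  \<open>ex_barrier_expansion\<close> feeds into partial fractions.\<close>

lemma Im_barrier_nonneg: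
  assumes u: "\<And>r. u r \<le> B r" and x: "0 < Im x" and "i \<noteq> j"
  shows "0 \<le> Im (barrier f j ((\<lambda>r. of_real (u r))(i := x)))"
proof -
  let ?Z = "(\<lambda>r. complex_of_real (u r))(i := x)"
  have Zj: "?Z j = of_real (u j)" using \<open>i \<noteq> j\<close> by simp
  have Z: "?Z(j := of_real (u j)) = ?Z" using \<open>i \<noteq> j\<close> by auto
  have fZ: "f ?Z \<noteq> 0" by (rule nonzero_mixed_single[OF u x])
  define q where "q = pcompose (section_poly f j ?Z) [:of_real (u j), 1:]"
  have q: "poly q y = f (?Z(j := of_real (u j) + y))" for y
    by (simp add: q_def poly_pcompose section_poly add.commute)
  have q0: "poly q 0 = f ?Z" unfolding q using Z by simp
  have "degree q \<le> k" using section_poly(2)[of j ?Z] by (simp add: q_def degree_pcompose)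
  then obtain a where a: "q = smult (f ?Z) (\<Prod>l<k. [:1, - a l:])"
    using reciprocal_root_factorization[of q k] q0 fZ by auto
  have "0 \<le> Im (a l)" if l: "l < k" for l
  proof (rule ccontr)
    assume neg: "\<not> 0 \<le> Im (a l)"
    then have "a l \<noteq> 0" by auto
    then have "poly q (1 / a l) = 0"
      unfolding a poly_smult poly_prod_reciprocal using l by auto
    moreover have "0 < Im (1 / a l)"
      using neg by (simp add: Im_divide divide_neg_pos sum_power2_gt_zero_iff)
    then have "f (?Z(j := of_real (u j) + 1 / a l)) \<noteq> 0"
      by (intro nonzero_mixed[OF u x]) simp
    ultimately show False by (simp add: q)
  qed
  moreover have "poly (pderiv (section_poly f j ?Z)) (of_real (u j)) = poly (pderiv q) 0"
    by (simp add: q_def pderiv_pcompose poly_pcompose pderiv_pCons)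
  then have "poly (pderiv (section_poly f j ?Z)) (of_real (u j)) = coeff q (Suc 0)"
    by (simp add: poly_0_coeff_0 coeff_pderiv)
  then have "barrier f j ?Z = (\<Sum>l<k. a l)"
    unfolding barrier_def Zj using fZ by (simp add: a coeff_prod_reciprocal)
  ultimately show ?thesis by (auto intro!: sum_nonneg)
qed

end

section \<open>Monotonicity of the barrier under contraction of a variable\<close>

lemma poly_pderiv_prod_reciprocal:
  assumes "finite I"
  shows "poly (pderiv (\<Prod>l\<in>I. [:1, - a l:])) x = - (\<Sum>l\<in>I. a l * (\<Prod>i\<in>I-{l}. 1 - a i * (x::'a::field)))"
  by (simp add: pderiv_prod poly_sum poly_prod pderiv_pCons sum_negf mult.commute)

lemma sum_prod_remove_divide:
  fixes c :: "'b \<Rightarrow> 'a::field"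
  assumes "finite I" "\<And>l. l \<in> I \<Longrightarrow> y l \<noteq> 0"
  shows "(\<Sum>l\<in>I. c l * (\<Prod>i\<in>I-{l}. y i)) / (\<Prod>i\<in>I. y i) = (\<Sum>l\<in>I. c l / y l)"
proof -
  have "c l * (\<Prod>i\<in>I-{l}. y i) / (\<Prod>i\<in>I. y i) = c l / y l" if "l \<in> I" for l
    using prod.remove[OF assms(1) that, of y] assms that by (simp add: divide_simps)
  then show ?thesis by (simp add: sum_divide_distrib)
qed

context stable_poly
begin

lemma barrier_eq_sum:
  assumes eq: "section_poly f i (\<lambda>r. of_real (u r)) = smult C (\<Prod>l<k. [:1, - of_real (a l):])"
    and C: "C \<noteq> 0" and a: "\<And>l. l < k \<Longrightarrow> a l * u i \<noteq> 1"
  shows "barrier f i (\<lambda>r. of_real (u r)) = of_real (\<Sum>l<k. a l / (1 - a l * u i))"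
proof -
  let ?U = "\<lambda>r. complex_of_real (u r)"
  have ne: "1 - complex_of_real (a l) * of_real (u i) \<noteq> 0" if "l < k" for l
    using a[OF that] by (metis eq_iff_diff_eq_0 of_real_eq_1_iff of_real_mult)
  have "f ?U = poly (section_poly f i ?U) (of_real (u i))"
    by (simp add: section_poly fun_upd_idem)
  also have "\<dots> = C * (\<Prod>l<k. 1 - of_real (a l) * of_real (u i))"
    by (simp add: eq poly_prod_reciprocal)
  finally have fU: "f ?U = C * (\<Prod>l<k. 1 - of_real (a l) * of_real (u i))" .
  have "barrier f i ?U = (\<Sum>l<k. of_real (a l) * (\<Prod>j\<in>{..<k}-{l}. 1 - of_real (a j) * of_real (u i))) /
      (\<Prod>l<k. 1 - of_real (a l) * of_real (u i))"
    unfolding barrier_def fU eq using C by (simp add: pderiv_smult poly_pderiv_prod_reciprocal)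
  also have "\<dots> = (\<Sum>l<k. of_real (a l) / (1 - of_real (a l) * of_real (u i)))"
    using ne by (intro sum_prod_remove_divide) auto
  finally show ?thesis by simp
qed

text \<open>
  The expansion \<open>b + (\<Sum>l<k. r l * x / (1 - a l * x))\<close> of the barrier in direction \<open>j\<close> along the
  \<open>i\<close>-th coordinate, with denominators cleared; \<open>c l\<close> is the coefficient of \<open>x ^ l\<close> as a polynomial
  in the \<open>j\<close>-th coordinate.
\<close>

definition barrier_expansion ::
  "nat \<Rightarrow> nat \<Rightarrow> (nat \<Rightarrow> real) \<Rightarrow> (nat \<Rightarrow> real) \<Rightarrow> (nat \<Rightarrow> real) \<Rightarrow> complex \<Rightarrow> (nat \<Rightarrow> complex poly) \<Rightarrow> bool" where
  "barrier_expansion i j u a r b c \<longleftrightarrow> (let U = (\<lambda>r. complex_of_real (u r)) in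
    (\<forall>l<k. 0 \<le> a l \<and> a l * B i < 1) \<and> (\<forall>l<k. 0 \<le> r l) \<and> f (U(i := 0)) \<noteq> 0 \<and>
    section_poly f i U = smult (f (U(i := 0))) (\<Prod>l<k. [:1, - of_real (a l):]) \<and>
    (\<forall>x. section_poly f j (U(i := x)) = (\<Sum>l\<le>k. smult (x ^ l) (c l))) \<and>
    (\<forall>w. section_poly f i (U(j := w)) = (\<Sum>l\<le>k. monom (poly (c l) w) l)) \<and>
    (\<Sum>l\<le>k. monom (- poly (pderiv (c l)) (of_real (u j))) l) =
      smult (f (U(i := 0))) (smult b (\<Prod>l<k. [:1, - of_real (a l):]) +
        (\<Sum>l<k. smult (of_real (r l)) ([:0, 1:] * (\<Prod>i\<in>{..<k}-{l}. [:1, - of_real (a i):])))))"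

lemma ex_barrier_expansion:
  assumes u: "\<And>r. u r \<le> B r" and "i \<noteq> j"
  shows "\<exists>a r b c. barrier_expansion i j u a r b c"
proof -
  define U where "U = (\<lambda>r. complex_of_real (u r))"
  obtain a where a: "\<And>l. l < k \<Longrightarrow> 0 \<le> a l \<and> a l * B i < 1"
    and C: "f (U(i := 0)) \<noteq> 0"
    and eq: "section_poly f i U = smult (f (U(i := 0))) (\<Prod>l<k. [:1, - of_real (a l):])"
    using real_factorization[of u i, OF u] unfolding U_def by blast
  obtain c where c1: "\<And>x. section_poly f j (U(i := x)) = (\<Sum>l\<le>k. smult (x ^ l) (c l))"
    and c2: "\<And>w. section_poly f i (U(j := w)) = (\<Sum>l\<le>k. monom (poly (c l) w) l)"
    using bivariate_sections[OF \<open>i \<noteq> j\<close>, of U] by blast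
  \<comment> \<open>Numerator of the barrier along coordinate \<open>i\<close>; like the denominator
    it has degree at most \<open>k\<close> in \<open>x\<close>.\<close>
  define H where "H = (\<Sum>l\<le>k. monom (- poly (pderiv (c l)) (of_real (u j))) l)"
  have H: "poly H x = - poly (pderiv (section_poly f j (U(i := x)))) (of_real (u j))" for x
    unfolding c1 H_def by (simp add: poly_sum poly_monom pderiv_sum pderiv_smult sum_negf mult.commute)
  have fU: "f (U(i := x)) = f (U(i := 0)) * (\<Prod>l<k. 1 - of_real (a l) * x)" for x
    unfolding section_poly(1)[symmetric, of U i x] eq by (simp add: poly_prod_reciprocal)
  define h where "h = smult (1 / f (U(i := 0))) H"
  have "degree H \<le> k"
    unfolding H_def by (intro degree_sum_le) (auto intro: order_trans[OF degree_monom_le])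
  then have "degree h \<le> card {..<k}" using C by (simp add: h_def)
  moreover have "0 \<le> Im (poly h x / (\<Prod>i\<in>{..<k}. 1 - of_real (a i) * x))" if x: "0 < Im x" for x
  proof -
    have "poly h x / (\<Prod>i\<in>{..<k}. 1 - of_real (a i) * x) = barrier f j (U(i := x))"
      unfolding barrier_def fU[of x] using \<open>i \<noteq> j\<close> by (simp add: h_def H U_def)
    then show ?thesis using Im_barrier_nonneg[of u, OF u x \<open>i \<noteq> j\<close>] by (simp add: U_def)
  qed
  ultimately have "\<exists>b r. (\<forall>l\<in>{..<k}. 0 \<le> (r l :: real)) \<and>
    h = smult b (\<Prod>i<k. [:1, - of_real (a i):]) +
        (\<Sum>l<k. smult (of_real (r l)) ([:0, 1:] * (\<Prod>i\<in>{..<k}-{l}. [:1, - of_real (a i):])))"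
    by (rule partial_fractions_upper_half_plane[OF finite_lessThan])
  then obtain b r where r: "\<forall>l\<in>{..<k}. 0 \<le> (r l :: real)" and
    h: "h = smult b (\<Prod>i<k. [:1, - of_real (a i):]) +
        (\<Sum>l<k. smult (of_real (r l)) ([:0, 1:] * (\<Prod>i\<in>{..<k}-{l}. [:1, - of_real (a i):])))"
    by blast
  have "H = smult (f (U(i := 0))) h" using C by (simp add: h_def)
  then have "H = smult (f (U(i := 0))) (smult b (\<Prod>l<k. [:1, - of_real (a l):]) +
        (\<Sum>l<k. smult (of_real (r l)) ([:0, 1:] * (\<Prod>i\<in>{..<k}-{l}. [:1, - of_real (a i):]))))"
    by (simp only: h)
  then have "barrier_expansion i j u a r b c"
    unfolding barrier_expansion_def Let_def U_def[symmetric] H_def using a r C eq c1 c2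
    by (intro conjI allI impI) (simp_all only: lessThan_iff not_False_eq_True)
  then show ?thesis by blast
qed

text \<open>Each term \<open>r l * x / (1 - a l * x)\<close> with nonnegative \<open>r l\<close>
  increases on the part of the line up to \<open>B i\<close>, where its denominator is
  positive.\<close>

lemma barrier_mono_coordinate:
  assumes u: "\<And>r. u r \<le> B r" and "i \<noteq> j" and s: "s \<le> t" and t: "t \<le> B i"
  shows "Re (barrier f j (\<lambda>r. of_real ((u(i := s)) r))) \<le> Re (barrier f j (\<lambda>r. of_real ((u(i := t)) r)))"
proof -
  define U where "U = (\<lambda>r. complex_of_real (u r))"
  obtain a r b c where ex: "barrier_expansion i j u a r b c"
    using ex_barrier_expansion[of u i j, OF u \<open>i \<noteq> j\<close>] by blast
  note ex = ex[unfolded barrier_expansion_def Let_def U_def[symmetric]]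
  note rest = ex[THEN conjunct2, THEN conjunct2, THEN conjunct2, THEN conjunct2]
  have a: "0 \<le> a l \<and> a l * B i < 1" if "l < k" for l
    using ex[THEN conjunct1] that by simp
  have r: "0 \<le> r l" if "l < k" for l
    using ex[THEN conjunct2, THEN conjunct1] that by simp
  note C = ex[THEN conjunct2, THEN conjunct2, THEN conjunct1]
  note eq = ex[THEN conjunct2, THEN conjunct2, THEN conjunct2, THEN conjunct1]
  note c1 = rest[THEN conjunct1, rule_format]
  note H = rest[THEN conjunct2, THEN conjunct2]
  have pos: "0 < 1 - a l * x" if "l < k" "x \<le> B i" for l x
  proof -
    have "a l * x \<le> a l * B i" using a[OF that(1)] that(2) by (intro mult_left_mono) auto
    then show ?thesis using a[OF that(1)] by linarith
  qed
  have form: "barrier f j (\<lambda>r. of_real ((u(i := x)) r)) = b + of_real (\<Sum>l<k. r l * x / (1 - a l * x))"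
    if x: "x \<le> B i" for x
  proof -
    have ne: "1 - complex_of_real (a l) * of_real x \<noteq> 0" if "l < k" for l
      using pos[OF that x] by (metis eq_iff_diff_eq_0 less_irrefl of_real_eq_1_iff of_real_mult)
    have Ux: "(\<lambda>r. complex_of_real ((u(i := x)) r)) = U(i := of_real x)" by (auto simp: U_def)
    have fU: "f (U(i := of_real x)) = f (U(i := 0)) * (\<Prod>l<k. 1 - of_real (a l) * of_real x)"
      unfolding section_poly(1)[symmetric, of U i "of_real x"] eq by (simp add: poly_prod_reciprocal)
    have "- poly (pderiv (section_poly f j (U(i := of_real x)))) (of_real (u j)) =
      poly (\<Sum>l\<le>k. monom (- poly (pderiv (c l)) (of_real (u j))) l) (of_real x)"
      unfolding c1 by (simp add: poly_sum poly_monom pderiv_sum pderiv_smult sum_negf mult.commute)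
    also have "\<dots> = f (U(i := 0)) * (b * (\<Prod>l<k. 1 - of_real (a l) * of_real x) +
       (\<Sum>l<k. (of_real (r l) * of_real x) * (\<Prod>i\<in>{..<k}-{l}. 1 - of_real (a i) * of_real x)))"
      unfolding H by (simp add: poly_sum poly_prod_reciprocal ac_simps)
    finally have "barrier f j (U(i := of_real x)) =
      (b * (\<Prod>l<k. 1 - of_real (a l) * of_real x) +
       (\<Sum>l<k. (of_real (r l) * of_real x) * (\<Prod>i\<in>{..<k}-{l}. 1 - of_real (a i) * of_real x))) /
       (\<Prod>l<k. 1 - of_real (a l) * of_real x)"
      unfolding barrier_def fU using \<open>i \<noteq> j\<close> C by (simp add: U_def)
    also have "\<dots> = b + (\<Sum>l<k. (of_real (r l) * of_real x) / (1 - of_real (a l) * of_real x))"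
      using ne by (subst sum_prod_remove_divide[symmetric]) (auto simp: add_divide_distrib)
    finally show ?thesis unfolding Ux by simp
  qed
  have "r l * s / (1 - a l * s) \<le> r l * t / (1 - a l * t)" if l: "l < k" for l
  proof -
    have "r l * s * (1 - a l * t) \<le> r l * t * (1 - a l * s)"
      using mult_left_mono[OF s r[OF l]] by (simp add: algebra_simps)
    then show ?thesis using pos[OF l t] pos[OF l order_trans[OF s t]] by (simp add: divide_simps mult.commute)
  qed
  then show ?thesis unfolding form[OF t] form[OF order_trans[OF s t]] by (auto intro!: sum_mono)
qed

text \<open>Coordinates are raised one after another, and \<open>dep\<close> makes finitely many
  moves enough. Coordinate \<open>j\<close> has to stay fixed, since the expansion describes the
  barrier in \<open>j\<close> only along the other coordinates.\<close>

lemma barrier_mono: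
  assumes dep: "\<And>z z'. (\<And>r. r < m \<Longrightarrow> z r = z' r) \<Longrightarrow> f z = f z'"
    and uv: "\<And>r. u r \<le> v r" and v: "\<And>r. v r \<le> B r" and j: "u j = v j"
  shows "Re (barrier f j (\<lambda>r. of_real (u r))) \<le> Re (barrier f j (\<lambda>r. of_real (v r)))"
proof -
  define w where "w n r = (if r < n then v r else u r)" for n r
  have w: "w n r \<le> B r" for n r using uv[of r] v[of r] by (auto simp: w_def)
  have "Re (barrier f j (\<lambda>r. of_real (u r))) \<le> Re (barrier f j (\<lambda>r. of_real (w n r)))" for n
  proof (induction n)
    case (Suc n)
    have "w (Suc n) = (w n)(n := v n)" "w n = (w n)(n := u n)"
      by (auto simp: w_def fun_eq_iff less_Suc_eq)
    moreover have "Re (barrier f j (\<lambda>r. of_real (((w n)(n := u n)) r))) \<le> Re (barrier f j (\<lambda>r. of_real (((w n)(n := v n)) r)))"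
    proof (cases "n = j")
      case False
      show ?thesis by (rule barrier_mono_coordinate[OF w False uv v])
    qed (simp add: j)
    ultimately show ?case using Suc by (metis order_trans)
  qed (simp add: w_def)
  moreover have "barrier f j (\<lambda>r. of_real (w m r)) = barrier f j (\<lambda>r. of_real (v r))"
  proof -
    have "section_poly f j (\<lambda>r. of_real (w m r)) = section_poly f j (\<lambda>r. of_real (v r))"
      by (rule section_poly_eqI, unfold section_poly, rule dep) (auto simp: w_def)
    moreover have "f (\<lambda>r. of_real (w m r)) = f (\<lambda>r. of_real (v r))" by (rule dep) (auto simp: w_def)
    moreover have "w m j = v j" using j by (simp add: w_def)
    ultimately show ?thesis by (simp add: barrier_def)
  qed
  ultimately show ?thesis by metis
qed

text \<open>Along coordinate \<open>i\<close> the new function is a constant times 1 - A x / k,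
  where A is the sum of the \<open>a l\<close>. Its barrier in \<open>j\<close> is b + R x / (k - A
  x), where R is the sum of the \<open>r l\<close> of the expansion for \<open>f\<close>; hence
  \<open>cond\<close> compares the barriers term by term. \<open>cond\<close> ranges over all
  \<open>a\<close> because the factorisation is only known to exist; the barrier equation is the
  caller's means of controlling \<open>a\<close>. Stability survives because A = k / z is impossible
  for A in the closed and z in the open upper half-plane.\<close>

lemma contraction_step:
  fixes \<tau> :: real
  assumes g: "separately_poly k g"
    and contraction: "\<And>z. g z = coeff (section_poly f i z) 0 + coeff (section_poly f i z) 1 * z i / of_nat k"
    and dep: "\<And>z z'. (\<And>r. r < m \<Longrightarrow> z r = z' r) \<Longrightarrow> f z = f z'"
    and \<tau>: "0 < \<tau>"
    and cond: "\<And>a :: nat \<Rightarrow> real. (\<And>l. l < k \<Longrightarrow> 0 \<le> a l \<and> a l * B i < 1) \<Longrightarrow>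
      barrier f i (\<lambda>r. of_real (B r)) = of_real (\<Sum>l<k. a l / (1 - a l * B i)) \<Longrightarrow>
      (\<Sum>l<k. a l) * \<tau> < k \<and> (\<forall>l<k. \<tau> / (k - (\<Sum>l<k. a l) * \<tau>) \<le> B i / (1 - a l * B i))"
  shows "stable_poly k g (B(i := \<tau>))"
    and "j \<noteq> i \<Longrightarrow> Re (barrier g j (\<lambda>r. of_real ((B(i := \<tau>)) r))) \<le> Re (barrier f j (\<lambda>r. of_real (B r)))"
proof -
  have k: "0 < real k" using k_pos by simp
  have g_eq: "g z = C * (1 - (\<Sum>l<k. a l) * z i / of_nat k)"
    if "section_poly f i z = smult C (\<Prod>l<k. [:1, - a l:])" for z C a
    unfolding contraction that by (simp add: coeff_prod_reciprocal algebra_simps)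
  obtain a0 where a0: "\<And>l. l < k \<Longrightarrow> 0 \<le> a0 l \<and> a0 l * B i < 1"
    and C0: "f ((\<lambda>r. of_real (B r))(i := 0)) \<noteq> 0"
    and eq0: "section_poly f i (\<lambda>r. of_real (B r)) =
      smult (f ((\<lambda>r. of_real (B r))(i := 0))) (\<Prod>l<k. [:1, - of_real (a0 l):])"
    using real_factorization[of B i] by blast
  have "(\<Sum>l<k. a0 l) * \<tau> < k"
  proof -
    have ne0: "a0 l * B i \<noteq> 1" if "l < k" for l using a0[OF that] by simp
    have "barrier f i (\<lambda>r. of_real (B r)) = of_real (\<Sum>l<k. a0 l / (1 - a0 l * B i))"
      by (intro barrier_eq_sum[OF eq0 C0] ne0)
    from cond[of a0, OF a0 this] show ?thesis by simp
  qed
  \<comment> \<open>With coordinate \<open>i\<close> at 0 the barrier in direction \<open>i\<close>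
    equals the sum of the reciprocal roots. Monotonicity of the barrier therefore makes this sum
    largest when the other coordinates are those of \<open>B\<close>.\<close>
  have sum_le: "(\<Sum>l<k. a l) \<le> (\<Sum>l<k. a0 l)"
    if u: "\<And>r. r \<noteq> i \<Longrightarrow> u r \<le> B r" and C: "C \<noteq> 0"
      and eq: "section_poly f i (\<lambda>r. of_real (u r)) = smult C (\<Prod>l<k. [:1, - of_real (a l):])" for u C a
  proof -
    have upd: "(\<lambda>r. complex_of_real ((w(i := 0)) r)) = (\<lambda>r. complex_of_real (w r))(i := 0)" for w
      by auto
    have "barrier f i (\<lambda>r. of_real ((u(i := 0)) r)) = of_real (\<Sum>l<k. a l / (1 - a l * (u(i := 0)) i))"
      using eq C by (intro barrier_eq_sum[where C = C]) (simp_all only: upd section_poly_upd, auto)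
    moreover have "barrier f i (\<lambda>r. of_real ((B(i := 0)) r)) = of_real (\<Sum>l<k. a0 l / (1 - a0 l * (B(i := 0)) i))"
      using eq0 C0 by (intro barrier_eq_sum) (simp_all only: upd section_poly_upd, auto)
    moreover have "Re (barrier f i (\<lambda>r. of_real ((u(i := 0)) r))) \<le> Re (barrier f i (\<lambda>r. of_real ((B(i := 0)) r)))"
      using u by (intro barrier_mono[OF dep]) (auto simp: less_imp_le[OF B_pos[of i]])
    ultimately show ?thesis by simp
  qed
  show "stable_poly k g (B(i := \<tau>))"
  proof (intro stable_poly.intro g stable_poly_axioms.intro)
    fix z :: "nat \<Rightarrow> complex" assume z: "\<And>r. 0 < Im (z r) \<or> z r = 0"
    obtain a where a: "\<And>l. l < k \<Longrightarrow> 0 \<le> Im (a l)" and C: "f (z(i := 0)) \<noteq> 0"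
      and eq: "section_poly f i z = smult (f (z(i := 0))) (\<Prod>l<k. [:1, - a l:])"
      using stable_factorization[of i z] z by blast
    show "g z \<noteq> 0"
    proof
      assume "g z = 0"
      then have 1: "(\<Sum>l<k. a l) * z i = of_nat k" using C k_pos unfolding g_eq[OF eq] by simp
      then have "z i \<noteq> 0" using k_pos by auto
      then have im: "0 < Im (z i)" using z[of i] by simp
      have "(\<Sum>l<k. a l) = of_nat k / z i" using 1 \<open>z i \<noteq> 0\<close> by (simp add: field_simps)
      moreover have "Im (of_nat k / z i) < 0"
        using im k_pos by (simp add: Im_divide divide_neg_pos sum_power2_gt_zero_iff)
      moreover have "0 \<le> Im (\<Sum>l<k. a l)" using a by (auto intro!: sum_nonneg)
      ultimately show False by simp
    qed
  next
    show "0 < (B(i := \<tau>)) r" for r using B_pos \<tau> by simp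
  next
    fix u :: "nat \<Rightarrow> real" assume u: "\<And>r. u r \<le> (B(i := \<tau>)) r"
    have u': "u r \<le> B r" if "r \<noteq> i" for r using u[of r] that by simp
    have ui: "u i \<le> \<tau>" using u[of i] by simp
    \<comment> \<open>\<open>u i\<close> may lie above \<open>B i\<close>, but the section in
      \<open>i\<close> does not depend on it, and 0 is a safe value.\<close>
    let ?v = "u(i := 0)"
    have "?v r \<le> B r" for r using u'[of r] B_pos[of r] by (cases "r = i") (auto simp: less_imp_le)
    then obtain a where a: "\<And>l. l < k \<Longrightarrow> 0 \<le> a l \<and> a l * B i < 1"
      and C: "f ((\<lambda>r. of_real (?v r))(i := 0)) \<noteq> 0"
      and eq: "section_poly f i (\<lambda>r. of_real (?v r)) =
        smult (f ((\<lambda>r. of_real (?v r))(i := 0))) (\<Prod>l<k. [:1, - of_real (a l):])"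
      using real_factorization[of ?v i] by blast
    define C' where "C' = f ((\<lambda>r. of_real (?v r))(i := 0))"
    have "(\<lambda>r. complex_of_real (?v r)) = (\<lambda>r. complex_of_real (u r))(i := 0)" by auto
    then have eq': "section_poly f i (\<lambda>r. of_real (u r)) = smult C' (\<Prod>l<k. [:1, - of_real (a l):])"
      using eq unfolding C'_def by (simp only: section_poly_upd)
    have le: "(\<Sum>l<k. a l) \<le> (\<Sum>l<k. a0 l)" using u' C eq' by (intro sum_le[of u C']) (auto simp: C'_def)
    have nonneg: "0 \<le> (\<Sum>l<k. a l)" using a by (auto intro!: sum_nonneg)
    have "(\<Sum>l<k. a l) * u i \<le> (\<Sum>l<k. a l) * \<tau>" using ui nonneg by (rule mult_left_mono)
    also have "\<dots> \<le> (\<Sum>l<k. a0 l) * \<tau>" using le \<tau> by (intro mult_right_mono) auto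
    also have "\<dots> < k" by fact
    finally have "1 - (\<Sum>l<k. a l) * u i / k \<noteq> 0" using k by (simp add: divide_simps)
    then have "complex_of_real (1 - (\<Sum>l<k. a l) * u i / k) \<noteq> 0" by (simp only: of_real_eq_0_iff not_False_eq_True)
    then show "g (\<lambda>r. of_real (u r)) \<noteq> 0" using C unfolding g_eq[OF eq'] C'_def by simp
  qed
  assume ji: "j \<noteq> i"
  define U where "U = (\<lambda>r. complex_of_real (B r))"
  obtain a r b c where ex: "barrier_expansion i j B a r b c"
    using ex_barrier_expansion[of B i j, OF order_refl ji[symmetric]] by blast
  note ex = ex[unfolded barrier_expansion_def Let_def U_def[symmetric]]
  note rest = ex[THEN conjunct2, THEN conjunct2, THEN conjunct2, THEN conjunct2]
  have a: "0 \<le> a l \<and> a l * B i < 1" if "l < k" for l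
    using ex[THEN conjunct1] that by simp
  have r: "0 \<le> r l" if "l < k" for l
    using ex[THEN conjunct2, THEN conjunct1] that by simp
  note C = ex[THEN conjunct2, THEN conjunct2, THEN conjunct1]
  note eq = ex[THEN conjunct2, THEN conjunct2, THEN conjunct2, THEN conjunct1]
  note c1 = rest[THEN conjunct1, rule_format]
  note c2 = rest[THEN conjunct2, THEN conjunct1, rule_format]
  note H = rest[THEN conjunct2, THEN conjunct2]
  define A where "A = (\<Sum>l<k. a l)"
  define R where "R = (\<Sum>l<k. r l)"
  have ne: "a l * B i \<noteq> 1" if "l < k" for l using a[OF that] by simp
  have "barrier f i U = of_real (\<Sum>l<k. a l / (1 - a l * B i))"
    unfolding U_def by (intro barrier_eq_sum[OF eq[unfolded U_def] C[unfolded U_def]] ne)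
  note cond' = cond[of a, OF a this[unfolded U_def]]
  have "A * \<tau> < k" using cond' by (simp add: A_def)
  have A: "\<tau> / (k - A * \<tau>) \<le> B i / (1 - a l * B i)" if "l < k" for l
    using cond' that by (simp add: A_def)
  \<comment> \<open>Only the coefficients 0 and 1 in coordinate \<open>i\<close> enter
    \<open>g\<close>, so the expansion with cleared denominators is read off at these two.\<close>
  have d0: "- poly (pderiv (c 0)) (of_real (B j)) = f (U(i := 0)) * b"
    using arg_cong[OF H, of "\<lambda>p. coeff p 0"]
    by (simp add: coeff_sum coeff_prod_reciprocal if_distrib cong: if_cong)
  have d1: "- poly (pderiv (c 1)) (of_real (B j)) = f (U(i := 0)) * (of_real R - b * of_real A)"
  proof -
    have "coeff (\<Sum>l\<le>k. monom (- poly (pderiv (c l)) (of_real (B j))) l) 1 = - poly (pderiv (c 1)) (of_real (B j))"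
      using k_pos by (simp add: coeff_sum if_distrib cong: if_cong)
    moreover have "coeff ([:0, 1:] * (\<Prod>i\<in>{..<k}-{l}. [:1, - complex_of_real (a i):])) 1 = 1" for l
      by (simp add: coeff_prod_reciprocal)
    ultimately show ?thesis
      unfolding H by (simp add: coeff_sum coeff_prod_reciprocal A_def R_def algebra_simps)
  qed
  let ?V = "\<lambda>r. complex_of_real ((B(i := \<tau>)) r)"
  have V: "?V = U(i := of_real \<tau>)" by (auto simp: U_def)
  have sec: "section_poly g j ?V = c 0 + smult (of_real \<tau> / of_nat k) (c 1)"
  proof (rule section_poly_eqI)
    fix w
    have upd: "?V(j := w) = (U(j := w))(i := of_real \<tau>)" using ji unfolding V by (rule fun_upd_twist[symmetric])
    have co: "coeff (section_poly f i (U(j := w))) l = poly (c l) w" if "l \<le> k" for l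
      using that unfolding c2 by (simp add: coeff_sum if_distrib cong: if_cong)
    show "poly (c 0 + smult (of_real \<tau> / of_nat k) (c 1)) w = g (?V(j := w))"
      unfolding contraction upd section_poly_upd using co[of 0] co[of 1] k_pos by simp
  qed
  have gV: "g ?V = f (U(i := 0)) * of_real (1 - A * \<tau> / k)"
    unfolding V using g_eq[of "U(i := of_real \<tau>)"] eq by (simp add: section_poly_upd A_def)
  have pos: "0 < 1 - A * \<tau> / k" using \<open>A * \<tau> < k\<close> k by simp
  have "- poly (pderiv (section_poly g j ?V)) (?V j) =
    f (U(i := 0)) * (b * of_real (1 - A * \<tau> / k) + of_real (R * (\<tau> / k)))"
  proof -
    have "- poly (pderiv (section_poly g j ?V)) (?V j) =
      - poly (pderiv (c 0)) (of_real (B j)) + of_real (\<tau> / k) * (- poly (pderiv (c 1)) (of_real (B j)))"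
      unfolding sec using ji by (simp add: pderiv_add pderiv_smult)
    then show ?thesis unfolding d0 d1 by (simp add: algebra_simps)
  qed
  then have "barrier g j ?V = (b * of_real (1 - A * \<tau> / k) + of_real (R * (\<tau> / k))) / of_real (1 - A * \<tau> / k)"
    unfolding barrier_def gV using C by simp
  also have "\<dots> = b + of_real (R * (\<tau> / k) / (1 - A * \<tau> / k))"
  proof -
    have "(b * of_real p + of_real q) / of_real p = b + of_real (q / p)" if "p \<noteq> 0" for p q :: real
      using that by (simp add: add_divide_distrib)
    then show ?thesis using pos by (metis less_irrefl)
  qed
  also have "R * (\<tau> / k) / (1 - A * \<tau> / k) = R * (\<tau> / (k - A * \<tau>))"
    using \<open>A * \<tau> < k\<close> k by (simp add: divide_simps)
  also have "\<dots> = (\<Sum>l<k. r l * (\<tau> / (k - A * \<tau>)))"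
    by (simp only: R_def sum_distrib_right)
  finally have bg: "Re (barrier g j ?V) = Re b + (\<Sum>l<k. r l * (\<tau> / (k - A * \<tau>)))" by simp
  have "barrier f j U = b + of_real (\<Sum>l<k. r l * (B i / (1 - a l * B i)))"
  proof -
    let ?x = "complex_of_real (B i)"
    have ne': "1 - complex_of_real (a l) * ?x \<noteq> 0" if "l < k" for l
      using ne[OF that] by (metis eq_iff_diff_eq_0 of_real_eq_1_iff of_real_mult)
    have Ux: "U(i := ?x) = U" by (auto simp: U_def)
    have fU: "f U = f (U(i := 0)) * (\<Prod>l<k. 1 - of_real (a l) * ?x)"
      using section_poly(1)[of i U ?x] unfolding eq Ux by (simp add: poly_prod_reciprocal)
    have "- poly (pderiv (section_poly f j U)) (of_real (B j)) =
      poly (\<Sum>l\<le>k. monom (- poly (pderiv (c l)) (of_real (B j))) l) ?x"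
      using c1[of ?x] unfolding Ux by (simp add: poly_sum poly_monom pderiv_sum pderiv_smult sum_negf mult.commute)
    also have "\<dots> = f (U(i := 0)) * (b * (\<Prod>l<k. 1 - of_real (a l) * ?x) +
       (\<Sum>l<k. (of_real (r l) * ?x) * (\<Prod>i\<in>{..<k}-{l}. 1 - of_real (a i) * ?x)))"
      unfolding H by (simp add: poly_sum poly_prod_reciprocal ac_simps)
    finally have "barrier f j U =
      (b * (\<Prod>l<k. 1 - of_real (a l) * ?x) +
       (\<Sum>l<k. (of_real (r l) * ?x) * (\<Prod>i\<in>{..<k}-{l}. 1 - of_real (a i) * ?x))) /
       (\<Prod>l<k. 1 - of_real (a l) * ?x)"
      unfolding barrier_def fU using C by (simp add: U_def)
    also have "\<dots> = b + (\<Sum>l<k. (of_real (r l) * ?x) / (1 - of_real (a l) * ?x))"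
      using ne' by (subst sum_prod_remove_divide[symmetric]) (auto simp: add_divide_distrib)
    finally show ?thesis by simp
  qed
  then have bf: "Re (barrier f j U) = Re b + (\<Sum>l<k. r l * (B i / (1 - a l * B i)))" by simp
  show "Re (barrier g j ?V) \<le> Re (barrier f j (\<lambda>r. of_real (B r)))"
    unfolding bg bf[unfolded U_def] by (intro add_left_mono sum_mono mult_left_mono) (simp_all only: lessThan_iff A r)
qed

end

text \<open>Cleared of fractions, the last conclusion asks that k / \<tau> be at least 1 / \<beta>
  plus the sum of the \<open>a i\<close> with \<open>i \<noteq> l\<close>. By convexity these k - 1
  numbers have the largest total under \<open>sum\<close> when all equal \<phi> / (k - 1 + \<beta>
  \<phi>); the formula for \<tau> is equality for that extreme total.\<close>

lemma step_condition:
  fixes a :: "nat \<Rightarrow> real"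
  assumes \<beta>: "0 < \<beta>" and \<phi>: "0 \<le> \<phi>" and k: "2 \<le> k"
    and a: "\<And>l. l < k \<Longrightarrow> 0 \<le> a l \<and> a l * \<beta> < 1"
    and sum: "(\<Sum>l<k. a l / (1 - a l * \<beta>)) \<le> \<phi>"
    and \<tau>: "\<tau> = k / (1 / \<beta> + \<phi> * (real k - 1) / (real k - 1 + \<beta> * \<phi>))"
  shows "0 < \<tau>" "(\<Sum>l<k. a l) * \<tau> < k"
    and "l < k \<Longrightarrow> \<tau> / (k - (\<Sum>l<k. a l) * \<tau>) \<le> \<beta> / (1 - a l * \<beta>)"
proof -
  define K where "K = real k - 1"
  have K: "1 \<le> K" using k by (simp add: K_def)
  define D where "D = K + \<beta> * \<phi>"
  have D: "0 < D" using K \<beta> \<phi> by (simp add: D_def add_pos_nonneg)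
  have rest: "(\<Sum>i\<in>{..<k}-{l}. a i) \<le> \<phi> * K / D" if l: "l < k" for l
  proof -
    \<comment> \<open>\<open>p\<close> is \<open>1 - t * \<beta>\<close> at the point of tangency
      \<open>t = \<phi> / D\<close>, so the slope there is \<open>1 / p\<^sup>2\<close>.\<close>
    define p where "p = K / D"
    have p: "0 < p" using K D by (simp add: p_def)
    \<comment> \<open>tangent at \<open>\<phi> / D\<close> to the convex function \<open>t / (1 - t * \<beta>)\<close>, which takes the value \<open>\<phi> / K\<close> there\<close>
    have tangent: "\<phi> / K + (a i - \<phi> / D) / p\<^sup>2 \<le> a i / (1 - a i * \<beta>)" if i: "i < k" for i
    proof -
      define x where "x = 1 - a i * \<beta>"
      have x: "0 < x" using a[OF i] by (simp add: x_def)
      have px: "p - x = \<beta> * (a i - \<phi> / D)"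
        using D unfolding p_def x_def by (simp add: D_def field_simps)
      define e where "e = a i - \<phi> / D"
      have e: "e = (a i * D - \<phi>) / D" using D by (simp add: e_def field_simps)
      have "a i / x - \<phi> / K = (a i * K - \<phi> * x) / (x * K)" using x K by (simp add: field_simps)
      also have "a i * K - \<phi> * x = a i * D - \<phi>" by (simp add: x_def D_def algebra_simps)
      also have "(a i * D - \<phi>) / (x * K) = e / (x * p)" unfolding e p_def using D by simp
      finally have "a i / x - (\<phi> / K + e / p\<^sup>2) = e / (x * p) - e / p\<^sup>2" by simp
      also have "\<dots> = e * (p - x) / (x * p\<^sup>2)"
        using x p by (simp add: field_simps power2_eq_square)
      finally have "a i / x - (\<phi> / K + (a i - \<phi> / D) / p\<^sup>2) = (a i - \<phi> / D) * (p - x) / (x * p\<^sup>2)"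
        by (simp only: e_def)
      also have "\<dots> = \<beta> * (a i - \<phi> / D)\<^sup>2 / (x * p\<^sup>2)" unfolding px by (simp add: power2_eq_square)
      also have "0 \<le> \<dots>" using \<beta> x p by simp
      finally show ?thesis by (simp add: x_def)
    qed
    have card: "real (card ({..<k}-{l})) = K" using l k by (simp add: K_def of_nat_diff)
    have "(\<Sum>i\<in>{..<k}-{l}. \<phi> / K + (a i - \<phi> / D) / p\<^sup>2) \<le> (\<Sum>i\<in>{..<k}-{l}. a i / (1 - a i * \<beta>))"
      by (intro sum_mono tangent) auto
    also have "\<dots> \<le> (\<Sum>i<k. a i / (1 - a i * \<beta>))"
      by (rule sum_mono2) (auto simp: a less_imp_le)
    also have "\<dots> \<le> \<phi>" by (rule sum)
    finally have "\<phi> + ((\<Sum>i\<in>{..<k}-{l}. a i) - K * (\<phi> / D)) / p\<^sup>2 \<le> \<phi>"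
      using K by (simp add: sum.distrib sum_divide_distrib[symmetric] sum_subtractf card)
    then have "((\<Sum>i\<in>{..<k}-{l}. a i) - K * (\<phi> / D)) / p\<^sup>2 \<le> 0" by linarith
    then show ?thesis using p by (simp add: divide_le_0_iff mult.commute)
  qed
  have \<tau>': "\<tau> = k / (1 / \<beta> + \<phi> * K / D)" by (simp add: \<tau> K_def D_def)
  have den: "0 < 1 / \<beta> + \<phi> * K / D" using \<beta> \<phi> K D by (intro add_pos_nonneg) auto
  show \<tau>_pos: "0 < \<tau>" unfolding \<tau>' using den k by simp
  have k\<tau>: "k / \<tau> = 1 / \<beta> + \<phi> * K / D" unfolding \<tau>' using den k by simp
  have gap: "(1 - a l * \<beta>) / \<beta> \<le> k / \<tau> - (\<Sum>l<k. a l)" if l: "l < k" for l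
  proof -
    have "(\<Sum>i<k. a i) = a l + (\<Sum>i\<in>{..<k}-{l}. a i)" using l by (intro sum.remove) auto
    then show ?thesis unfolding k\<tau> using rest[OF l] \<beta> by (simp add: diff_divide_distrib)
  qed
  have mid: "k - (\<Sum>l<k. a l) * \<tau> = \<tau> * (k / \<tau> - (\<Sum>l<k. a l))"
    using \<tau>_pos by (simp add: field_simps)
  have gpos: "0 < k / \<tau> - (\<Sum>l<k. a l)"
  proof -
    have "0 < (1 - a 0 * \<beta>) / \<beta>" using a[of 0] \<beta> k by simp
    then show ?thesis using gap[of 0] k by linarith
  qed
  have "0 < k - (\<Sum>l<k. a l) * \<tau>" unfolding mid using \<tau>_pos gpos by simp
  then show "(\<Sum>l<k. a l) * \<tau> < k" by simp
  show "\<tau> / (k - (\<Sum>l<k. a l) * \<tau>) \<le> \<beta> / (1 - a l * \<beta>)" if l: "l < k"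
  proof -
    have "\<tau> / (k - (\<Sum>l<k. a l) * \<tau>) = 1 / (k / \<tau> - (\<Sum>l<k. a l))" unfolding mid using \<tau>_pos by simp
    also have "\<dots> \<le> 1 / ((1 - a l * \<beta>) / \<beta>)"
      using gap[OF l] gpos a[OF l] \<beta> by (intro divide_left_mono) auto
    finally show ?thesis by simp
  qed
qed

section \<open>Determinants with weighted rows\<close>

definition multiaffine :: "((nat \<Rightarrow> complex) \<Rightarrow> complex) \<Rightarrow> bool" where
  "multiaffine G \<longleftrightarrow> (\<forall>w r. \<exists>a b. \<forall>x. G (w(r := x)) = a + b * x)"

lemma multiaffine_upd:
  assumes "multiaffine G"
  shows "G (w(r := w r + x)) = G w + x * (G (w(r := w r + 1)) - G w)"
proof -
  obtain a b where "\<And>x. G (w(r := x)) = a + b * x" using assms unfolding multiaffine_def by blast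
  note ab = this this[of "w r", unfolded fun_upd_triv]
  show ?thesis unfolding ab by (simp add: algebra_simps)
qed

text \<open>The derivative along the diagonal of \<open>S\<close> is the sum of the partial
  derivatives, and for a function affine in each coordinate a partial derivative is a unit
  difference.\<close>

lemma multiaffine_block:
  assumes G: "multiaffine G" and "finite S"
  shows "\<exists>q. degree q \<le> card S \<and> (\<forall>x. poly q x = G (\<lambda>r. if r \<in> S then w r + x else w r)) \<and>
    coeff q 0 = G w \<and> coeff q 1 = (\<Sum>r\<in>S. G (w(r := w r + 1)) - G w)"
  using \<open>finite S\<close>
proof (induction S arbitrary: w)
  case empty
  show ?case by (intro exI[of _ "[:G w:]"]) simp
next
  case (insert s S)
  obtain q where q: "degree q \<le> card S" "\<And>x. poly q x = G (\<lambda>r. if r \<in> S then w r + x else w r)"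
    "coeff q 0 = G w" "coeff q 1 = (\<Sum>r\<in>S. G (w(r := w r + 1)) - G w)"
    using insert.IH[of w] by blast
  let ?w = "w(s := w s + 1)"
  obtain p where p: "degree p \<le> card S" "\<And>x. poly p x = G (\<lambda>r. if r \<in> S then ?w r + x else ?w r)"
    "coeff p 0 = G ?w"
    using insert.IH[of ?w] by blast
  \<comment> \<open>Affinity in coordinate \<open>s\<close>: interpolation between the increments 0
    (\<open>q\<close>) and 1 (\<open>p\<close>).\<close>
  let ?q = "q + [:0, 1:] * (p - q)"
  have "degree ([:0, 1:] * (p - q)) \<le> Suc (card S)"
    using degree_mult_le[of "[:0, 1:]" "p - q"] degree_diff_le[OF p(1) q(1)] by simp
  then have "degree ?q \<le> card (insert s S)"
    using insert.hyps q(1) by (intro degree_add_le) auto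
  moreover have "poly ?q x = G (\<lambda>r. if r \<in> insert s S then w r + x else w r)" for x
  proof -
    let ?b = "\<lambda>r. if r \<in> S then w r + x else w r"
    have "(\<lambda>r. if r \<in> insert s S then w r + x else w r) = ?b(s := ?b s + x)"
      using insert.hyps by auto
    moreover have "(\<lambda>r. if r \<in> S then ?w r + x else ?w r) = ?b(s := ?b s + 1)"
      using insert.hyps by auto
    ultimately show ?thesis using multiaffine_upd[OF G, of ?b s x] by (simp add: p(2) q(2))
  qed
  moreover have "coeff ?q 0 = G w" using q(3) by simp
  moreover have "coeff ?q 1 = (\<Sum>r\<in>insert s S. G (w(r := w r + 1)) - G w)"
    using insert.hyps p(3) q(3,4) by simp
  ultimately show ?case by blast
qed

text \<open>The determinant of I - diag(w) A. Weighting the rows, instead of conjugating A by square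
  roots of the weights, keeps it affine in each weight and allows arbitrary complex weights.\<close>

definition row_det :: "nat \<Rightarrow> (nat \<Rightarrow> nat \<Rightarrow> complex) \<Rightarrow> (nat \<Rightarrow> complex) \<Rightarrow> complex" where
  "row_det N A w = det (mat N N (\<lambda>(r, c). (if r = c then 1 else 0) - w r * A r c))"

lemma row_det_Leibniz:
  "row_det N A w = (\<Sum>p | p permutes {0..<N}. signof p * (\<Prod>r = 0..<N. (if r = p r then 1 else 0) - w r * A r (p r)))"
proof -
  let ?M = "mat N N (\<lambda>(r, c). (if r = c then 1 else 0) - w r * A r c)"
  have "det ?M = (\<Sum>p | p permutes {0..<N}. signof p * (\<Prod>r = 0..<N. ?M $$ (r, p r)))"
    by (rule det_def') simp
  also have "\<dots> = (\<Sum>p | p permutes {0..<N}. signof p * (\<Prod>r = 0..<N. (if r = p r then 1 else 0) - w r * A r (p r)))"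
  proof (intro sum.cong prod.cong arg_cong2[where f = "(*)"] refl)
    fix p r assume "p \<in> {p. p permutes {0..<N}}" "r \<in> {0..<N}"
    then show "?M $$ (r, p r) = (if r = p r then 1 else 0) - w r * A r (p r)"
      using permutes_in_image[of p "{0..<N}" r] by simp
  qed
  finally show ?thesis by (simp only: row_det_def)
qed

lemma row_det_cong: "(\<And>r. r < N \<Longrightarrow> w r = w' r) \<Longrightarrow> row_det N A w = row_det N A w'"
  unfolding row_det_Leibniz by (intro sum.cong prod.cong arg_cong2[where f = "(*)"]) auto

lemma multiaffine_row_det: "multiaffine (row_det N A)"
  unfolding multiaffine_def
proof (intro allI)
  fix w r
  show "\<exists>a b. \<forall>x. row_det N A (w(r := x)) = a + b * x"
  proof (cases "r < N")
    case True
    let ?P = "\<lambda>p. \<Prod>i\<in>{0..<N}-{r}. (if i = p i then 1 else 0) - w i * A i (p i)"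
    let ?a = "\<Sum>p | p permutes {0..<N}. signof p * ((if r = p r then 1 else 0) * ?P p)"
    let ?b = "\<Sum>p | p permutes {0..<N}. - signof p * (A r (p r) * ?P p)"
    have "row_det N A (w(r := x)) = ?a + ?b * x" for x
    proof -
      have "(\<Prod>i = 0..<N. (if i = p i then 1 else 0) - (w(r := x)) i * A i (p i)) =
        ((if r = p r then 1 else 0) - x * A r (p r)) * ?P p" for p
      proof -
        have "(\<Prod>i = 0..<N. (if i = p i then 1 else 0) - (w(r := x)) i * A i (p i)) =
          ((if r = p r then 1 else 0) - (w(r := x)) r * A r (p r)) *
          (\<Prod>i\<in>{0..<N}-{r}. (if i = p i then 1 else 0) - (w(r := x)) i * A i (p i))"
          using True by (intro prod.remove) auto
        also have "(\<Prod>i\<in>{0..<N}-{r}. (if i = p i then 1 else 0) - (w(r := x)) i * A i (p i)) = ?P p"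
          by (intro prod.cong) auto
        finally show ?thesis by simp
      qed
      then have "row_det N A (w(r := x)) = (\<Sum>p | p permutes {0..<N}.
          signof p * (((if r = p r then 1 else 0) - x * A r (p r)) * ?P p))"
        by (simp only: row_det_Leibniz)
      also have "\<dots> = ?a + ?b * x"
        unfolding sum_distrib_right sum.distrib[symmetric]
      proof (rule sum.cong[OF refl])
        fix p
        have "\<sigma> * ((e - x * y) * P) = \<sigma> * (e * P) + - \<sigma> * (y * P) * x" for \<sigma> e y P :: complex
          by (simp add: algebra_simps)
        then show "signof p * (((if r = p r then 1 else 0) - x * A r (p r)) * ?P p) =
          signof p * ((if r = p r then 1 else 0) * ?P p) + - signof p * (A r (p r) * ?P p) * x" .
      qed
      finally show ?thesis .
    qed
    then show ?thesis by blast
  next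
    case False
    then have "row_det N A (w(r := x)) = row_det N A w + 0 * x" for x
      using row_det_cong[of N "w(r := x)" w A] by simp
    then show ?thesis by blast
  qed
qed

lemma tendsto_row_det:
  assumes "\<And>r. ((\<lambda>t. g t r) \<longlongrightarrow> l r) F"
  shows "((\<lambda>t. row_det N A (g t)) \<longlongrightarrow> row_det N A l) F"
  unfolding row_det_Leibniz by (intro tendsto_intros assms)

text \<open>At fixed points of \<open>p\<close> both factors agree; the other points are permuted
  among themselves, so their weights \<open>c\<close> have the same product. In the Leibniz formula
  this moves weights from columns to rows.\<close>

lemma prod_permutes_shift:
  assumes p: "p permutes S" and "finite S"
  shows "(\<Prod>r\<in>S. (if r = p r then 1 else 0) - c (p r) * (y r :: complex)) = (\<Prod>r\<in>S. (if r = p r then 1 else 0) - c r * y r)"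
proof -
  let ?E = "{r\<in>S. r \<noteq> p r}"
  have S: "S = {r\<in>S. r = p r} \<union> ?E" by auto
  have split: "(\<Prod>r\<in>S. h r) = (\<Prod>r\<in>{r\<in>S. r = p r}. h r) * (\<Prod>r\<in>?E. h r)" for h :: "_ \<Rightarrow> complex"
    by (subst S, rule prod.union_disjoint) (use \<open>finite S\<close> in auto)
  have "bij_betw p ?E ?E"
  proof -
    have "inj_on p ?E" using permutes_inj[OF p] by (auto simp: inj_on_def inj_def)
    moreover have "p ` ?E \<subseteq> ?E" using permutes_in_image[OF p] permutes_inj[OF p] by (auto simp: inj_def)
    ultimately show ?thesis
      using endo_inj_surj[of ?E p] \<open>finite S\<close> by (simp add: bij_betw_def)
  qed
  then have "(\<Prod>r\<in>?E. c (p r)) = (\<Prod>r\<in>?E. c r)" by (rule prod.reindex_bij_betw)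
  moreover have "(\<Prod>r\<in>?E. (if r = p r then 1 else 0) - d r * y r) = (\<Prod>r\<in>?E. d r) * (\<Prod>r\<in>?E. - y r)" for d
    unfolding prod.distrib[symmetric] by (intro prod.cong) auto
  moreover have "(\<Prod>r\<in>{r\<in>S. r = p r}. (if r = p r then 1 else 0) - c (p r) * y r) =
    (\<Prod>r\<in>{r\<in>S. r = p r}. (if r = p r then 1 else 0) - c r * y r)"
    by (intro prod.cong) auto
  ultimately show ?thesis unfolding split by simp
qed

section \<open>Zero-free regions of weighted determinants of a Hermitian contraction\<close>

locale hermitian_contraction =
  fixes N :: nat and A :: "nat \<Rightarrow> nat \<Rightarrow> complex"
  assumes herm: "r < N \<Longrightarrow> c < N \<Longrightarrow> A r c = cnj (A c r)"
    and psd: "0 \<le> Re (\<Sum>r<N. (\<Sum>c<N. A r c * x c) * cnj (x r))"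
    and le_one: "Re (\<Sum>r<N. (\<Sum>c<N. A r c * x c) * cnj (x r)) \<le> (\<Sum>r<N. (norm (x r))\<^sup>2)"
begin

definition app :: "(nat \<Rightarrow> complex) \<Rightarrow> nat \<Rightarrow> complex" where
  "app x r = (\<Sum>c<N. A r c * x c)"

definition form :: "(nat \<Rightarrow> complex) \<Rightarrow> (nat \<Rightarrow> complex) \<Rightarrow> complex" where
  "form x y = (\<Sum>r<N. app x r * cnj (y r))"

lemma form_nonneg: "0 \<le> Re (form x x)"
  using psd[of x] by (simp add: form_def app_def)

lemma form_le: "Re (form x x) \<le> (\<Sum>r<N. (norm (x r))\<^sup>2)"
  using le_one[of x] by (simp add: form_def app_def)

lemma form_cnj: "form x y = cnj (form y x)"
proof -
  have "form x y = (\<Sum>r<N. \<Sum>c<N. A r c * x c * cnj (y r))"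
    by (simp add: form_def app_def sum_distrib_right)
  also have "\<dots> = (\<Sum>c<N. \<Sum>r<N. A r c * x c * cnj (y r))" by (rule sum.swap)
  also have "\<dots> = (\<Sum>c<N. \<Sum>r<N. cnj (A c r * y r * cnj (x c)))"
  proof (intro sum.cong refl)
    fix c r assume "c \<in> {..<N}" "r \<in> {..<N}"
    then have "cnj (A c r) = A r c" using herm[of r c] by simp
    then show "A r c * x c * cnj (y r) = cnj (A c r * y r * cnj (x c))"
      by (simp only: complex_cnj_mult complex_cnj_cnj mult_ac)
  qed
  finally show ?thesis by (simp add: form_def app_def sum_distrib_right)
qed

lemma form_add: "form (\<lambda>r. x r + y r) (\<lambda>r. x r + y r) = form x x + form x y + form y x + form y y"
  by (simp add: form_def app_def distrib_left distrib_right sum.distrib)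

lemma form_uminus: "form x (\<lambda>r. - y r) = - form x y" "form (\<lambda>r. - x r) y = - form x y"
  by (simp_all add: form_def app_def sum_negf)

lemma form_app: "form x (app x) = of_real (\<Sum>r<N. (norm (app x r))\<^sup>2)"
  by (simp only: form_def complex_norm_square of_real_sum)

text \<open>That is \<open>A\<^sup>2 \<le> A\<close>, obtained from \<open>A \<ge> 0\<close> at \<open>x - A x\<close> and \<open>A \<le> 1\<close> at \<open>A x\<close>.\<close>

lemma norm_app_le: "(\<Sum>r<N. (norm (app x r))\<^sup>2) \<le> Re (form x x)"
proof -
  let ?d = "\<lambda>r. x r + (- app x r)"
  have "form ?d ?d = form x x - form x (app x) - form (app x) x + form (app x) (app x)"
    unfolding form_add[of x "\<lambda>r. - app x r"] by (simp add: form_uminus)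
  moreover have "form (app x) x = form x (app x)"
    using form_cnj[of "app x" x] by (simp add: form_app del: of_real_sum of_real_power)
  ultimately have "Re (form ?d ?d) = Re (form x x) - 2 * (\<Sum>r<N. (norm (app x r))\<^sup>2) + Re (form (app x) (app x))"
    by (simp add: form_app del: of_real_sum of_real_power)
  then show ?thesis using form_nonneg[of ?d] form_le[of "app x"] by linarith
qed

text \<open>Cauchy-Schwarz for the semidefinite form, applied to \<open>x\<close> and the
  \<open>r\<close>-th unit vector.\<close>

lemma norm_app_entry_le:
  assumes r: "r < N"
  shows "(norm (app x r))\<^sup>2 \<le> Re (A r r) * Re (form x x)"
proof -
  define L where "L = (norm (app x r))\<^sup>2"
  let ?e = "\<lambda>c s. if s = r then c else (0::complex)"
  have app_e: "app (?e c) s = A s r * c" for c s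
    using r by (simp add: app_def if_distrib cong: if_cong)
  have form_e: "form x (?e c) = app x r * cnj c" for c
  proof -
    have "form x (?e c) = (\<Sum>s<N. if s = r then app x s * cnj c else 0)"
      unfolding form_def by (intro sum.cong) auto
    then show ?thesis using r by simp
  qed
  have form_ee: "form (?e c) (?e c) = A r r * c * cnj c" for c
  proof -
    have "form (?e c) (?e c) = (\<Sum>s<N. if s = r then A r r * c * cnj c else 0)"
      unfolding form_def by (intro sum.cong) (auto simp: app_e)
    then show ?thesis using r by simp
  qed
  have quad: "0 \<le> Re (form x x) - 2 * t * L + t\<^sup>2 * L * Re (A r r)" for t :: real
  proof -
    \<comment> \<open>Aligning the multiple of the unit vector with \<open>app x r\<close> makes
      both cross terms real.\<close>
    define c where "c = - of_real t * app x r"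
    have sq: "app x r * cnj (app x r) = of_real L" by (simp only: L_def complex_norm_square)
    have 1: "form x (?e c) = of_real (- t * L)"
      unfolding form_e c_def using sq by (simp add: algebra_simps)
    then have 2: "form (?e c) x = of_real (- t * L)" by (subst form_cnj) simp
    have 3: "form (?e c) (?e c) = A r r * of_real (t\<^sup>2 * L)"
      unfolding form_ee c_def using sq by (simp add: algebra_simps power2_eq_square)
    have "0 \<le> Re (form (\<lambda>s. x s + ?e c s) (\<lambda>s. x s + ?e c s))" by (rule form_nonneg)
    then show ?thesis unfolding form_add[of x "?e c"] 1 2 3 by (simp add: algebra_simps)
  qed
  have a: "0 \<le> Re (A r r)" using form_nonneg[of "?e 1"] unfolding form_ee by simp
  show ?thesis
  proof (cases "Re (A r r) = 0")
    case True
    have "L = 0"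
    proof (rule ccontr)
      assume "L \<noteq> 0"
      \<comment> \<open>Without diagonal entry the quadratic is linear in \<open>t\<close>; this
        \<open>t\<close> gives it the value - 1.\<close>
      then show False using quad[of "(Re (form x x) + 1) / (2 * L)"] True by simp
    qed
    then show ?thesis by (simp add: L_def True)
  next
    case False
    then have "0 \<le> Re (form x x) - L / Re (A r r)"
      using quad[of "1 / Re (A r r)"] by (simp add: power2_eq_square field_simps)
    then show ?thesis using a False by (simp add: L_def field_simps)
  qed
qed

lemma diag_nonneg: "r < N \<Longrightarrow> 0 \<le> Re (A r r)"
proof -
  assume r: "r < N"
  let ?e = "\<lambda>s. if s = r then (1::complex) else 0"
  have "form ?e ?e = (\<Sum>s<N. if s = r then A r r else 0)"
    unfolding form_def app_def using r by (intro sum.cong) (auto simp: if_distrib cong: if_cong)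
  then show ?thesis using form_nonneg[of ?e] r by simp
qed

text \<open>A kernel vector of I - diag(w) A satisfies v = diag(w) A v. Inserting this into the
  second argument of the form turns a zero of the determinant into an identity between the form at v
  and the entries of A v, from which both nonvanishing lemmas start.\<close>

lemma row_det_kernel:
  assumes "row_det N A w = 0"
  shows "\<exists>v. (\<exists>r<N. v r \<noteq> 0) \<and> (\<forall>r<N. v r = w r * app v r) \<and>
    form v v = (\<Sum>r<N. cnj (w r) * of_real ((norm (app v r))\<^sup>2))"
proof -
  let ?M = "mat N N (\<lambda>(r, c). (if r = c then 1 else 0) - w r * A r c)"
  obtain u where u: "u \<in> carrier_vec N" "u \<noteq> 0\<^sub>v N" "?M *\<^sub>v u = 0\<^sub>v N"
    using assms det_0_iff_vec_prod_zero[of ?M N] unfolding row_det_def by auto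
  have eq: "u $ r = w r * app (vec_index u) r" if r: "r < N" for r
  proof -
    have "0 = (?M *\<^sub>v u) $ r" using u(3) r by simp
    also have "\<dots> = (\<Sum>c<N. ((if r = c then 1 else 0) - w r * A r c) * u $ c)"
      using r u(1) by (simp add: scalar_prod_def atLeast0LessThan)
    also have "\<dots> = (\<Sum>c<N. if r = c then u $ c else 0) - (\<Sum>c<N. w r * (A r c * u $ c))"
      unfolding sum_subtractf[symmetric] by (intro sum.cong) (auto simp: algebra_simps)
    also have "\<dots> = u $ r - w r * app (vec_index u) r"
      using r by (simp add: app_def sum_distrib_left)
    finally show ?thesis by simp
  qed
  moreover have "\<exists>r<N. u $ r \<noteq> 0"
  proof (rule ccontr)
    assume "\<not> (\<exists>r<N. u $ r \<noteq> 0)"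
    then have "u = 0\<^sub>v N" using u(1) by (intro eq_vecI) auto
    then show False using u(2) by simp
  qed
  moreover have "form (vec_index u) (vec_index u) = (\<Sum>r<N. cnj (w r) * of_real ((norm (app (vec_index u) r))\<^sup>2))"
    unfolding form_def
  proof (rule sum.cong[OF refl])
    fix r assume "r \<in> {..<N}"
    then have "cnj (u $ r) = cnj (w r) * cnj (app (vec_index u) r)" using eq[of r] by (simp add: complex_eq_iff)
    then show "app (vec_index u) r * cnj (u $ r) = cnj (w r) * of_real ((norm (app (vec_index u) r))\<^sup>2)"
      by (simp only: complex_norm_square mult_ac)
  qed
  ultimately show ?thesis by blast
qed

text \<open>The form is real, so the nonnegative contributions of the imaginary parts of the weights
  sum to 0 and all vanish. Then \<open>w r\<close> or \<open>app v r\<close> is 0 in every row,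
  which gives \<open>v r = 0\<close>.\<close>

lemma row_det_stable:
  assumes w: "\<And>r. r < N \<Longrightarrow> 0 < Im (w r) \<or> w r = 0"
  shows "row_det N A w \<noteq> 0"
proof
  assume "row_det N A w = 0"
  then obtain v where v: "\<exists>r<N. v r \<noteq> 0" "\<forall>r<N. v r = w r * app v r"
    "form v v = (\<Sum>r<N. cnj (w r) * of_real ((norm (app v r))\<^sup>2))"
    using row_det_kernel by blast
  have "Im (form v v) = 0" using arg_cong[OF form_cnj[of v v], of Im] by simp
  then have "(\<Sum>r<N. Im (w r) * (norm (app v r))\<^sup>2) = 0"
    unfolding v(3) by (simp add: sum_negf del: of_real_power)
  moreover have "0 \<le> Im (w r) * (norm (app v r))\<^sup>2" if "r < N" for r
    using w[OF that] by auto
  ultimately have "Im (w r) * (norm (app v r))\<^sup>2 = 0" if "r < N" for r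
    using sum_nonneg_0[of "{..<N}" "\<lambda>r. Im (w r) * (norm (app v r))\<^sup>2" r] that by simp
  then have "v r = 0" if "r < N" for r
    using w[OF that] v(2)[rule_format, OF that] that by (metis less_irrefl mult_eq_0_iff norm_eq_zero zero_eq_power2)
  then show False using v(1) by blast
qed

text \<open>For a kernel vector, \<open>norm_app_le\<close> and \<open>norm_app_entry_le\<close>
  bound the form at v by \<beta> + d A_ss times itself, a factor below 1. The exceptional row
  \<open>s\<close> is there so that \<open>row_det_slope\<close> can follow the determinant along
  one row.\<close>

lemma row_det_real_nonzero:
  assumes w: "\<And>r. r < N \<Longrightarrow> r \<noteq> s \<Longrightarrow> w r \<le> \<beta>" and ws: "w s \<le> \<beta> + d" and s: "s < N"
    and \<beta>: "0 \<le> \<beta>" and d: "0 \<le> d" "\<beta> + d * Re (A s s) < 1"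
  shows "row_det N A (\<lambda>r. of_real (w r)) \<noteq> 0"
proof
  assume "row_det N A (\<lambda>r. of_real (w r)) = 0"
  then obtain v where v: "\<exists>r<N. v r \<noteq> 0" "\<forall>r<N. v r = of_real (w r) * app v r"
    "form v v = (\<Sum>r<N. cnj (of_real (w r)) * of_real ((norm (app v r))\<^sup>2))"
    using row_det_kernel by blast
  define n where "n r = (norm (app v r))\<^sup>2" for r
  have n: "0 \<le> n r" for r by (simp add: n_def)
  have "Re (form v v) = (\<Sum>r<N. w r * n r)" unfolding v(3) n_def by (simp del: of_real_power)
  also have "\<dots> \<le> (\<Sum>r<N. \<beta> * n r + (if r = s then d * n r else 0))"
  proof (rule sum_mono)
    fix r assume "r \<in> {..<N}"
    then have "w r \<le> \<beta> + (if r = s then d else 0)" using w[of r] ws by auto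
    then have "w r * n r \<le> (\<beta> + (if r = s then d else 0)) * n r" by (intro mult_right_mono n)
    then show "w r * n r \<le> \<beta> * n r + (if r = s then d * n r else 0)" by (simp add: distrib_right split: if_splits)
  qed
  also have "\<dots> = \<beta> * (\<Sum>r<N. n r) + d * n s" using s by (simp add: sum.distrib sum_distrib_left)
  also have "\<dots> \<le> \<beta> * Re (form v v) + d * (Re (A s s) * Re (form v v))"
    using norm_app_le[of v] norm_app_entry_le[OF s, of v] \<beta> d by (intro add_mono mult_left_mono) (auto simp: n_def)
  finally have "(1 - (\<beta> + d * Re (A s s))) * Re (form v v) \<le> 0" by (simp add: algebra_simps)
  then have "Re (form v v) \<le> 0" using d by (simp add: mult_le_0_iff)
  then have "(\<Sum>r<N. n r) \<le> 0" using norm_app_le[of v] by (simp add: n_def)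
  then have "(\<Sum>r<N. n r) = 0" using n by (intro antisym sum_nonneg) auto
  then have "n r = 0" if "r < N" for r using sum_nonneg_0[of "{..<N}" n r] n that by simp
  then have "v r = 0" if "r < N" for r using v(2)[rule_format, OF that] that by (simp add: n_def)
  then show False using v(1) by blast
qed

text \<open>Conjugating a Hermitian A transposes it, and transposing the determinant moves the
  weights to the columns; \<open>prod_permutes_shift\<close> brings them back.\<close>

lemma row_det_cnj: "row_det N A (\<lambda>r. cnj (w r)) = cnj (row_det N A w)"
proof -
  let ?M = "mat N N (\<lambda>(r, c). (if r = c then 1 else 0) - cnj (w r) * A r c)"
  have "row_det N A (\<lambda>r. cnj (w r)) = det (transpose_mat ?M)"
    unfolding row_det_def by (subst det_transpose[of ?M N]) auto
  also have "\<dots> = (\<Sum>p | p permutes {0..<N}. signof p * (\<Prod>r = 0..<N. transpose_mat ?M $$ (r, p r)))"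
    by (rule det_def') simp
  also have "\<dots> = (\<Sum>p | p permutes {0..<N}. cnj (signof p * (\<Prod>r = 0..<N. (if r = p r then 1 else 0) - w r * A r (p r))))"
  proof (rule sum.cong[OF refl])
    fix p assume "p \<in> {p. p permutes {0..<N}}"
    then have p: "p permutes {0..<N}" by simp
    have pN: "p r < N" if "r < N" for r using permutes_in_image[OF p, of r] that by simp
    have "(\<Prod>r = 0..<N. transpose_mat ?M $$ (r, p r)) =
      (\<Prod>r = 0..<N. (if r = p r then 1 else 0) - cnj (w (p r)) * A (p r) r)"
      by (intro prod.cong) (auto simp: pN)
    also have "\<dots> = (\<Prod>r = 0..<N. (if r = p r then 1 else 0) - cnj (w r) * A (p r) r)"
      by (rule prod_permutes_shift[OF p]) simp
    also have "\<dots> = (\<Prod>r = 0..<N. cnj ((if r = p r then 1 else 0) - w r * A r (p r)))"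
    proof (rule prod.cong[OF refl])
      fix r assume "r \<in> {0..<N}"
      then have "cnj (A r (p r)) = A (p r) r" using herm[of "p r" r] pN[of r] by simp
      then show "(if r = p r then 1 else 0) - cnj (w r) * A (p r) r = cnj ((if r = p r then 1 else 0) - w r * A r (p r))"
        by simp
    qed
    finally show "signof p * (\<Prod>r = 0..<N. transpose_mat ?M $$ (r, p r)) =
      cnj (signof p * (\<Prod>r = 0..<N. (if r = p r then 1 else 0) - w r * A r (p r)))"
      by (simp add: sign_def)
  qed
  finally show ?thesis by (simp add: row_det_Leibniz)
qed

text \<open>Along row \<open>s\<close> the determinant is affine. If the quotient \<theta> on the
  left is positive, there is a zero at increment 1 / \<theta>; \<open>row_det_real_nonzero\<close>
  excludes increments d \<ge> 0 with \<beta> + d A_ss < 1, so \<theta> cannot exceed the right-hand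
  side.\<close>

lemma row_det_slope:
  assumes s: "s < N" and \<beta>: "0 \<le> \<beta>" "\<beta> < 1"
  defines "w \<equiv> \<lambda>_. complex_of_real \<beta>"
  shows "Re (- (row_det N A (w(s := of_real \<beta> + 1)) - row_det N A w) / row_det N A w) \<le> Re (A s s) / (1 - \<beta>)"
proof -
  define \<theta> where "\<theta> = - (row_det N A (w(s := of_real \<beta> + 1)) - row_det N A w) / row_det N A w"
  have real: "row_det N A (\<lambda>r. of_real (u r)) = of_real (Re (row_det N A (\<lambda>r. of_real (u r))))" for u
    using row_det_cnj[of "\<lambda>r. of_real (u r)"] by (simp add: complex_eq_iff)
  have "row_det N A (\<lambda>r. of_real \<beta>) \<noteq> 0"
    by (rule row_det_real_nonzero[where w = "\<lambda>_. \<beta>" and \<beta> = \<beta> and d = 0 and s = s]) (use s \<beta> in auto)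
  then have G0: "row_det N A w \<noteq> 0" by (simp add: w_def)
  have upd: "w(s := of_real y) = (\<lambda>r. of_real (((\<lambda>_. \<beta>)(s := y)) r))" for y by (auto simp: w_def)
  have "\<theta> = of_real (Re \<theta>)"
  proof -
    have "w(s := of_real \<beta> + 1) = (\<lambda>r. of_real (((\<lambda>_. \<beta>)(s := \<beta> + 1)) r))" by (auto simp: w_def)
    then obtain p q where "row_det N A (w(s := of_real \<beta> + 1)) = of_real p" "row_det N A w = of_real q"
      using real[of "(\<lambda>_. \<beta>)(s := \<beta> + 1)"] real[of "\<lambda>_. \<beta>"] unfolding w_def by metis
    then have "\<theta> = of_real (- (p - q) / q)" by (simp add: \<theta>_def)
    then show ?thesis by simp
  qed
  then obtain t where t: "\<theta> = of_real t" by blast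
  have "t \<le> Re (A s s) / (1 - \<beta>)"
  proof (rule ccontr)
    assume "\<not> t \<le> Re (A s s) / (1 - \<beta>)"
    then have gt: "Re (A s s) / (1 - \<beta>) < t" by simp
    then have tpos: "0 < t" using diag_nonneg[OF s] \<beta> by (smt (verit) divide_nonneg_pos)
    have "Re (A s s) < t * (1 - \<beta>)" using gt \<beta> by (simp add: divide_less_eq)
    then have "\<beta> + 1 / t * Re (A s s) < 1" using tpos by (simp add: field_simps)
    then have "row_det N A (w(s := of_real (\<beta> + 1 / t))) \<noteq> 0"
      unfolding upd using s \<beta> tpos by (intro row_det_real_nonzero[where \<beta> = \<beta> and d = "1 / t" and s = s]) auto
    moreover have "row_det N A (w(s := of_real (\<beta> + 1 / t))) = row_det N A w + of_real (1 / t) * (- of_real t * row_det N A w)"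
    proof -
      have "row_det N A (w(s := of_real \<beta> + 1)) - row_det N A w = - of_real t * row_det N A w"
        using t G0 by (simp add: \<theta>_def field_simps)
      then show ?thesis
        using multiaffine_upd[OF multiaffine_row_det[of N A], of w s "of_real (1 / t)"] by (simp add: w_def)
    qed
    ultimately show False using tpos by simp
  qed
  then show ?thesis using t unfolding \<theta>_def by simp
qed

end

section \<open>Averages over block selections\<close>

text \<open>
  Rows of the first \<open>s\<close> blocks of variables are switched off unless selected by \<open>\<sigma>\<close>. Row \<open>r\<close> belongs
  to the variable \<open>r mod m\<close> and to the copy \<open>r div m\<close>.
\<close>

definition block_weights :: "nat \<Rightarrow> nat \<Rightarrow> (nat \<Rightarrow> nat) \<Rightarrow> (nat \<Rightarrow> complex) \<Rightarrow> nat \<Rightarrow> complex" where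
  "block_weights m s \<sigma> y r = (if r mod m < s \<and> r div m \<noteq> \<sigma> (r mod m) then 0 else y (r mod m))"

text \<open>Closed form of the iterated truncation: the mean over all choices of one copy for each
  of the first \<open>s\<close> variables. At \<open>s = m\<close> a single row per variable
  remains. \<open>F_contraction\<close> links consecutive \<open>s\<close>.\<close>

definition block_average :: "nat \<Rightarrow> nat \<Rightarrow> (nat \<Rightarrow> nat \<Rightarrow> complex) \<Rightarrow> nat \<Rightarrow> (nat \<Rightarrow> complex) \<Rightarrow> complex" where
  "block_average k m A s y =
    (\<Sum>\<sigma>\<in>{..<s} \<rightarrow>\<^sub>E {..<k}. row_det (k * m) A (block_weights m s \<sigma> y)) / of_nat k ^ s"

lemma bij_betw_block:
  assumes "i < (m::nat)"
  shows "bij_betw (\<lambda>j. i + j * m) {..<k} {r. r < k * m \<and> r mod m = i}"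
proof (rule bij_betw_byWitness[where f' = "\<lambda>r. r div m"])
  show "(\<lambda>j. i + j * m) ` {..<k} \<subseteq> {r. r < k * m \<and> r mod m = i}"
  proof clarsimp
    fix j assume "j < k"
    then have "Suc j * m \<le> k * m" by (intro mult_le_mono1) simp
    then show "i + j * m < k * m \<and> i mod m = i" using assms by simp
  qed
qed (use assms in \<open>auto simp: less_mult_imp_div_less\<close>)

lemma sum_block: "i < (m::nat) \<Longrightarrow> (\<Sum>r | r < k * m \<and> r mod m = i. h r) = (\<Sum>j<k. h (i + j * m))"
  using sum.reindex_bij_betw[OF bij_betw_block[of i m k], of h] by simp

lemma card_block: "i < m \<Longrightarrow> card {r. r < k * m \<and> r mod m = i} = k"
  using bij_betw_same_card[OF bij_betw_block, of i m k] by simp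

locale hermitian_block_contraction = hermitian_contraction "k * m" A for k m :: nat and A +
  assumes k_ge: "2 \<le> k" and m_pos: "0 < m"
begin

abbreviation "F \<equiv> block_average k m A"

lemma F_dep: "(\<And>r. r < m \<Longrightarrow> y r = y' r) \<Longrightarrow> F s y = F s y'"
  unfolding block_average_def block_weights_def using m_pos by (simp cong: if_cong)

lemma F_section:
  "\<exists>q. degree q \<le> k \<and> (\<forall>x. poly q x = F s (z(i := x)))"
proof -
  define S where "S \<sigma> = {r. r < k * m \<and> r mod m = i \<and> \<not> (r mod m < s \<and> r div m \<noteq> \<sigma> (r mod m))}" for \<sigma> :: "nat \<Rightarrow> nat"
  have S: "finite (S \<sigma>)" "card (S \<sigma>) \<le> k" for \<sigma>
  proof -
    show "finite (S \<sigma>)" by (simp add: S_def)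
    show "card (S \<sigma>) \<le> k"
    proof (cases "i < m")
      case True
      have "card (S \<sigma>) \<le> card {r. r < k * m \<and> r mod m = i}"
        by (rule card_mono) (auto simp: S_def)
      then show ?thesis using card_block[OF True, of k] by simp
    next
      case False
      then have "S \<sigma> = {}" using m_pos by (auto simp: S_def)
      then show ?thesis by simp
    qed
  qed
  have "\<exists>q. degree q \<le> k \<and> (\<forall>x. poly q x = row_det (k * m) A (block_weights m s \<sigma> (z(i := x))))" for \<sigma>
  proof -
    let ?w = "block_weights m s \<sigma> (z(i := 0))"
    obtain q where q: "degree q \<le> card (S \<sigma>)" "\<And>x. poly q x = row_det (k * m) A (\<lambda>r. if r \<in> S \<sigma> then ?w r + x else ?w r)"
      using multiaffine_block[OF multiaffine_row_det S(1), of \<sigma> "k * m" A ?w] by blast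
    have "row_det (k * m) A (\<lambda>r. if r \<in> S \<sigma> then ?w r + x else ?w r) = row_det (k * m) A (block_weights m s \<sigma> (z(i := x)))" for x
      by (rule row_det_cong) (auto simp: block_weights_def S_def)
    then show ?thesis using q S(2)[of \<sigma>] by (intro exI[of _ q]) auto
  qed
  then obtain q where q: "\<And>\<sigma>. degree (q \<sigma>) \<le> k" "\<And>\<sigma> x. poly (q \<sigma>) x = row_det (k * m) A (block_weights m s \<sigma> (z(i := x)))"
    by metis
  let ?q = "smult (1 / of_nat k ^ s) (\<Sum>\<sigma>\<in>{..<s} \<rightarrow>\<^sub>E {..<k}. q \<sigma>)"
  have "degree ?q \<le> k"
    by (rule order_trans[OF degree_smult_le]) (intro degree_sum_le finite_PiE q(1), auto)
  moreover have "poly ?q x = F s (z(i := x))" for x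
    by (simp add: block_average_def poly_sum q(2))
  ultimately show ?thesis by blast
qed

lemma separately_poly_F: "separately_poly k (F s)"
proof
  show "0 < k" using k_ge by simp
  show "\<exists>q. degree q \<le> k \<and> (\<forall>x. poly q x = F s (z(i := x)))" for z i by (rule F_section)
  show "F s (\<lambda>r. cnj (z r)) = cnj (F s z)" for z
  proof -
    have "block_weights m s \<sigma> (\<lambda>r. cnj (z r)) = (\<lambda>r. cnj (block_weights m s \<sigma> z r))" for \<sigma>
      by (auto simp: block_weights_def)
    then show ?thesis by (simp add: block_average_def row_det_cnj)
  qed
  fix g :: "real \<Rightarrow> nat \<Rightarrow> complex" and l
  assume g: "\<And>r. ((\<lambda>t. g t r) \<longlongrightarrow> l r) (at_right 0)"
  have "((\<lambda>t. block_weights m s \<sigma> (g t) r) \<longlongrightarrow> block_weights m s \<sigma> l r) (at_right 0)" for \<sigma> r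
    unfolding block_weights_def using g by (cases "r mod m < s \<and> r div m \<noteq> \<sigma> (r mod m)") auto
  then show "((\<lambda>t. F s (g t)) \<longlongrightarrow> F s l) (at_right 0)"
    unfolding block_average_def using k_ge by (intro tendsto_intros tendsto_row_det) auto
qed

text \<open>Moving the point \<open>c\<close> to 0 lets \<open>multiaffine_block\<close> give value
  and derivative together. The truncation uses this at \<open>c = 0\<close>, the initial barriers at
  \<open>c = \<beta>\<close>.\<close>

lemma section_coeffs:
  assumes i: "i < m"
    and w: "\<And>\<sigma> x. row_det (k * m) A (block_weights m s \<sigma> (z(i := c + x))) =
      row_det (k * m) A (\<lambda>r. if r < k * m \<and> r mod m = i then w \<sigma> r + x else w \<sigma> r)"
  shows "poly (section_poly (F s) i z) c = (\<Sum>\<sigma>\<in>{..<s} \<rightarrow>\<^sub>E {..<k}. row_det (k * m) A (w \<sigma>)) / of_nat k ^ s"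
    and "poly (pderiv (section_poly (F s) i z)) c =
      (\<Sum>\<sigma>\<in>{..<s} \<rightarrow>\<^sub>E {..<k}. \<Sum>r | r < k * m \<and> r mod m = i.
        row_det (k * m) A ((w \<sigma>)(r := w \<sigma> r + 1)) - row_det (k * m) A (w \<sigma>)) / of_nat k ^ s"
proof -
  interpret F: separately_poly k "F s" by (rule separately_poly_F)
  let ?S = "{r. r < k * m \<and> r mod m = i}"
  have "finite ?S" by simp
  note block = multiaffine_block[OF multiaffine_row_det this, of "k * m" A]
  have "\<exists>q. (\<forall>x. poly q x = row_det (k * m) A (\<lambda>r. if r \<in> ?S then w \<sigma> r + x else w \<sigma> r)) \<and>
    coeff q 0 = row_det (k * m) A (w \<sigma>) \<and>
    coeff q 1 = (\<Sum>r\<in>?S. row_det (k * m) A ((w \<sigma>)(r := w \<sigma> r + 1)) - row_det (k * m) A (w \<sigma>))" for \<sigma>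
    using block[of "w \<sigma>"] by blast
  then obtain q where q: "\<And>\<sigma> x. poly (q \<sigma>) x = row_det (k * m) A (\<lambda>r. if r \<in> ?S then w \<sigma> r + x else w \<sigma> r)"
    "\<And>\<sigma>. coeff (q \<sigma>) 0 = row_det (k * m) A (w \<sigma>)"
    "\<And>\<sigma>. coeff (q \<sigma>) 1 = (\<Sum>r\<in>?S. row_det (k * m) A ((w \<sigma>)(r := w \<sigma> r + 1)) - row_det (k * m) A (w \<sigma>))"
    by metis
  let ?q = "smult (1 / of_nat k ^ s) (\<Sum>\<sigma>\<in>{..<s} \<rightarrow>\<^sub>E {..<k}. q \<sigma>)"
  have "poly (pcompose (section_poly (F s) i z) [:c, 1:]) x = poly ?q x" for x
    unfolding poly_pcompose F.section_poly
    by (simp add: block_average_def poly_sum q(1) w F.section_poly)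
  then have eq: "pcompose (section_poly (F s) i z) [:c, 1:] = ?q"
    by (simp add: poly_eq_poly_eq_iff[symmetric] fun_eq_iff)
  have "poly (section_poly (F s) i z) c = poly (pcompose (section_poly (F s) i z) [:c, 1:]) 0"
    by (simp add: poly_pcompose)
  then show "poly (section_poly (F s) i z) c = (\<Sum>\<sigma>\<in>{..<s} \<rightarrow>\<^sub>E {..<k}. row_det (k * m) A (w \<sigma>)) / of_nat k ^ s"
    unfolding eq by (simp add: poly_0_coeff_0 coeff_sum q(2))
  have "poly (pderiv (section_poly (F s) i z)) c = poly (pderiv (pcompose (section_poly (F s) i z) [:c, 1:])) 0"
    by (simp add: pderiv_pcompose poly_pcompose pderiv_pCons)
  also have "\<dots> = coeff ?q 1" unfolding eq by (simp add: poly_0_coeff_0 coeff_pderiv)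
  finally show "poly (pderiv (section_poly (F s) i z)) c =
      (\<Sum>\<sigma>\<in>{..<s} \<rightarrow>\<^sub>E {..<k}. \<Sum>r | r < k * m \<and> r mod m = i.
        row_det (k * m) A ((w \<sigma>)(r := w \<sigma> r + 1)) - row_det (k * m) A (w \<sigma>)) / of_nat k ^ s"
    using q(3) by (simp add: coeff_sum)
qed

text \<open>At \<open>z s = 0\<close> all rows of block \<open>s\<close> are off, so the linear
  coefficient is the sum, over its \<open>k\<close> rows, of the effect of switching on that row
  alone. Extending \<sigma> by \<open>s := j\<close> switches on exactly row
  \<open>s + j * m\<close>, and the mean over \<open>j\<close> yields the factor 1 / k.\<close>

lemma F_contraction:
  assumes s: "s < m"
  shows "F (Suc s) z = coeff (section_poly (F s) s z) 0 + coeff (section_poly (F s) s z) 1 * z s / of_nat k"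
proof -
  let ?D = "row_det (k * m) A"
  let ?S = "{r. r < k * m \<and> r mod m = s}"
  define w where "w \<sigma> = block_weights m s \<sigma> (z(s := 0))" for \<sigma>
  have "?D (block_weights m s \<sigma> (z(s := 0 + x))) = ?D (\<lambda>r. if r < k * m \<and> r mod m = s then w \<sigma> r + x else w \<sigma> r)" for \<sigma> x
    by (rule row_det_cong) (auto simp: w_def block_weights_def)
  note co = section_coeffs[where c = 0, OF s this]
  have c0: "coeff (section_poly (F s) s z) 0 = (\<Sum>\<sigma>\<in>{..<s} \<rightarrow>\<^sub>E {..<k}. ?D (w \<sigma>)) / of_nat k ^ s"
    using co(1) by (simp add: poly_0_coeff_0)
  have w0: "w \<sigma> r = 0" if "r mod m = s" for \<sigma> r using that by (simp add: w_def block_weights_def)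
  have c1: "coeff (section_poly (F s) s z) 1 = (\<Sum>\<sigma>\<in>{..<s} \<rightarrow>\<^sub>E {..<k}. \<Sum>r\<in>?S. ?D ((w \<sigma>)(r := w \<sigma> r + 1)) - ?D (w \<sigma>)) / of_nat k ^ s"
    using co(2) by (simp add: poly_0_coeff_0 coeff_pderiv)
  have inner: "?D (w \<sigma>) + (\<Sum>r\<in>?S. ?D ((w \<sigma>)(r := w \<sigma> r + 1)) - ?D (w \<sigma>)) * z s / of_nat k =
    (\<Sum>j<k. ?D ((w \<sigma>)(s + j * m := z s))) / of_nat k" for \<sigma>
  proof -
    have "?D ((w \<sigma>)(s + j * m := z s)) = ?D (w \<sigma>) + z s * (?D ((w \<sigma>)(s + j * m := w \<sigma> (s + j * m) + 1)) - ?D (w \<sigma>))" for j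
      using multiaffine_upd[OF multiaffine_row_det[of "k * m" A], of "w \<sigma>" "s + j * m" "z s"] w0[of "s + j * m" \<sigma>] s by simp
    then have "(\<Sum>j<k. ?D ((w \<sigma>)(s + j * m := z s))) =
      of_nat k * ?D (w \<sigma>) + z s * (\<Sum>j<k. ?D ((w \<sigma>)(s + j * m := w \<sigma> (s + j * m) + 1)) - ?D (w \<sigma>))"
      by (simp add: sum.distrib sum_distrib_left)
    then show ?thesis using k_ge by (simp add: sum_block[OF s] add_divide_distrib mult.commute)
  qed
  have "(\<Sum>\<sigma>\<in>{..<Suc s} \<rightarrow>\<^sub>E {..<k}. ?D (block_weights m (Suc s) \<sigma> z)) =
    (\<Sum>(j, \<sigma>)\<in>{..<k} \<times> ({..<s} \<rightarrow>\<^sub>E {..<k}). ?D (block_weights m (Suc s) (\<sigma>(s := j)) z))"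
    unfolding lessThan_Suc PiE_insert_eq
    by (subst sum.reindex[OF inj_combinator]) (auto simp: case_prod_unfold intro!: sum.cong)
  also have "\<dots> = (\<Sum>(j, \<sigma>)\<in>{..<k} \<times> ({..<s} \<rightarrow>\<^sub>E {..<k}). ?D ((w \<sigma>)(s + j * m := z s)))"
  proof (intro sum.cong refl, clarify)
    fix j \<sigma> assume "j < k"
    have "block_weights m (Suc s) (\<sigma>(s := j)) z r = ((w \<sigma>)(s + j * m := z s)) r" for r
    proof (cases "r mod m = s")
      case True
      have "r = s + j * m \<longleftrightarrow> r div m = j"
      proof
        assume "r = s + j * m"
        then show "r div m = j" using s by simp
      next
        assume "r div m = j"
        then show "r = s + j * m" using True div_mult_mod_eq[of r m] by simp
      qed
      then show ?thesis using True by (auto simp: block_weights_def w_def)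
    next
      case False
      then have "r \<noteq> s + j * m" using s by auto
      then show ?thesis using False by (auto simp: block_weights_def w_def)
    qed
    then show "?D (block_weights m (Suc s) (\<sigma>(s := j)) z) = ?D ((w \<sigma>)(s + j * m := z s))"
      by (metis ext)
  qed
  also have "\<dots> = (\<Sum>\<sigma>\<in>{..<s} \<rightarrow>\<^sub>E {..<k}. \<Sum>j<k. ?D ((w \<sigma>)(s + j * m := z s)))"
    unfolding sum.cartesian_product[symmetric] by (rule sum.swap)
  finally have "F (Suc s) z = (\<Sum>\<sigma>\<in>{..<s} \<rightarrow>\<^sub>E {..<k}. (\<Sum>j<k. ?D ((w \<sigma>)(s + j * m := z s))) / of_nat k) / of_nat k ^ s"
    by (simp add: block_average_def sum_divide_distrib[symmetric] mult.commute)
  also have "\<dots> = (\<Sum>\<sigma>\<in>{..<s} \<rightarrow>\<^sub>E {..<k}. ?D (w \<sigma>) + (\<Sum>r\<in>?S. ?D ((w \<sigma>)(r := w \<sigma> r + 1)) - ?D (w \<sigma>)) * z s / of_nat k) / of_nat k ^ s"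
    unfolding inner ..
  also have "\<dots> = coeff (section_poly (F s) s z) 0 + coeff (section_poly (F s) s z) 1 * z s / of_nat k"
  proof -
    have "(\<Sum>\<sigma>\<in>P. a \<sigma> + X \<sigma> * z s / of_nat k) / c = (\<Sum>\<sigma>\<in>P. a \<sigma>) / c + (\<Sum>\<sigma>\<in>P. X \<sigma>) / c * z s / of_nat k"
      for P and a X :: "(nat \<Rightarrow> nat) \<Rightarrow> complex" and c
    proof -
      have "(\<Sum>\<sigma>\<in>P. X \<sigma> * z s / of_nat k) = (\<Sum>\<sigma>\<in>P. X \<sigma>) * z s / of_nat k"
        by (simp only: sum_distrib_right sum_divide_distrib)
      then show ?thesis by (simp add: sum.distrib add_divide_distrib)
    qed
    then show ?thesis unfolding c0 c1 .
  qed
  finally show ?thesis .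
qed

lemma F_0: "F 0 y = row_det (k * m) A (\<lambda>r. y (r mod m))"
  by (simp add: block_average_def block_weights_def)

lemma stable_F_0:
  assumes \<beta>: "0 < \<beta>" "\<beta> < 1"
  shows "stable_poly k (F 0) (\<lambda>_. \<beta>)"
proof (intro stable_poly.intro separately_poly_F stable_poly_axioms.intro)
  show "F 0 z \<noteq> 0" if "\<And>r. 0 < Im (z r) \<or> z r = 0" for z
    unfolding F_0 using that by (intro row_det_stable) auto
  show "0 < \<beta>" by fact
  show "F 0 (\<lambda>r. of_real (u r)) \<noteq> 0" if "\<And>r. u r \<le> \<beta>" for u
    unfolding F_0
    by (rule row_det_real_nonzero[where w = "\<lambda>r. u (r mod m)" and \<beta> = \<beta> and d = 0 and s = 0])
      (use that \<beta> k_ge m_pos in auto)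
qed

lemma barrier_F_0:
  assumes \<beta>: "0 < \<beta>" "\<beta> < 1" and i: "i < m"
    and \<epsilon>: "(\<Sum>j<k. Re (A (i + j * m) (i + j * m))) \<le> \<epsilon>"
  shows "Re (barrier (F 0) i (\<lambda>_. of_real \<beta>)) \<le> \<epsilon> / (1 - \<beta>)"
proof -
  let ?D = "row_det (k * m) A"
  let ?S = "{r. r < k * m \<and> r mod m = i}"
  define w where "w = (\<lambda>_ :: nat. complex_of_real \<beta>)"
  have "?D (block_weights m 0 \<sigma> ((\<lambda>_. of_real \<beta>)(i := of_real \<beta> + x))) = ?D (\<lambda>r. if r < k * m \<and> r mod m = i then w r + x else w r)" for \<sigma> x
    by (rule row_det_cong) (auto simp: w_def block_weights_def)
  from section_coeffs(2)[where w = "\<lambda>_. w", OF i this]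
  have sec: "poly (pderiv (section_poly (F 0) i (\<lambda>_. of_real \<beta>))) (of_real \<beta>) =
    (\<Sum>r\<in>?S. ?D (w(r := of_real \<beta> + 1)) - ?D w)"
    by (simp add: w_def)
  have "barrier (F 0) i (\<lambda>_. of_real \<beta>) = - (\<Sum>r\<in>?S. ?D (w(r := of_real \<beta> + 1)) - ?D w) / ?D w"
    unfolding barrier_def by (simp only: sec F_0 w_def)
  also have "\<dots> = (\<Sum>r\<in>?S. - (?D (w(r := of_real \<beta> + 1)) - ?D w) / ?D w)"
    by (simp only: sum_negf[symmetric] sum_divide_distrib)
  finally have "barrier (F 0) i (\<lambda>_. of_real \<beta>) = \<dots>" .
  then have "Re (barrier (F 0) i (\<lambda>_. of_real \<beta>)) = (\<Sum>r\<in>?S. Re (- (?D (w(r := of_real \<beta> + 1)) - ?D w) / ?D w))"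
    by (simp only: Re_sum)
  also have "\<dots> \<le> (\<Sum>r\<in>?S. Re (A r r) / (1 - \<beta>))"
    unfolding w_def using \<beta> by (intro sum_mono row_det_slope) auto
  also have "\<dots> = (\<Sum>j<k. Re (A (i + j * m) (i + j * m))) / (1 - \<beta>)"
    by (simp add: sum_block[OF i] sum_divide_distrib)
  also have "\<dots> \<le> \<epsilon> / (1 - \<beta>)" using \<epsilon> \<beta> by (intro divide_right_mono) auto
  finally show ?thesis .
qed

text \<open>Variables below \<open>s\<close> have been moved from \<beta> to \<tau>. The remaining
  barriers keep the initial bound \<phi>, because a contraction step does not increase them, so one
  \<tau> serves for all steps.\<close>

lemma stable_F:
  assumes \<beta>: "0 < \<beta>" "\<beta> < 1"
    and \<epsilon>: "\<And>i. i < m \<Longrightarrow> (\<Sum>j<k. Re (A (i + j * m) (i + j * m))) \<le> \<epsilon>"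
    and \<phi>: "\<phi> = \<epsilon> / (1 - \<beta>)"
    and \<tau>: "\<tau> = k / (1 / \<beta> + \<phi> * (real k - 1) / (real k - 1 + \<beta> * \<phi>))"
    and "s \<le> m"
  shows "stable_poly k (F s) (\<lambda>r. if r < s then \<tau> else \<beta>) \<and>
    (\<forall>j. s \<le> j \<and> j < m \<longrightarrow> Re (barrier (F s) j (\<lambda>r. of_real (if r < s then \<tau> else \<beta>))) \<le> \<phi>)"
  using \<open>s \<le> m\<close>
proof (induction s)
  case 0
  show ?case using stable_F_0[OF \<beta>] barrier_F_0[OF \<beta> _ \<epsilon>] by (simp add: \<phi>)
next
  case (Suc s)
  let ?B = "\<lambda>r. if r < s then \<tau> else \<beta>"
  have s: "s < m" using Suc.prems by simp
  have IH: "stable_poly k (F s) ?B"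
    and bar: "\<And>j. s \<le> j \<Longrightarrow> j < m \<Longrightarrow> Re (barrier (F s) j (\<lambda>r. of_real (?B r))) \<le> \<phi>"
    using Suc.IH s by auto
  interpret F: stable_poly k "F s" ?B by (rule IH)
  have "0 \<le> (\<Sum>j<k. Re (A (0 + j * m) (0 + j * m)))"
  proof (intro sum_nonneg diag_nonneg)
    fix j assume "j \<in> {..<k}"
    then show "0 + j * m < k * m" using m_pos by simp
  qed
  also have "\<dots> \<le> \<epsilon>" by (rule \<epsilon>[OF m_pos])
  finally have "0 \<le> \<phi>" using \<beta> by (simp add: \<phi>)
  note step = step_condition[OF \<beta>(1) this k_ge _ _ \<tau>]
  have "0 < \<tau>" using step(1)[of "\<lambda>_. 0"] \<open>0 \<le> \<phi>\<close> by simp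
  have upd: "?B(s := \<tau>) = (\<lambda>r. if r < Suc s then \<tau> else \<beta>)" by (auto simp: fun_eq_iff less_Suc_eq)
  have cond: "(\<Sum>l<k. a l) * \<tau> < k \<and> (\<forall>l<k. \<tau> / (k - (\<Sum>l<k. a l) * \<tau>) \<le> ?B s / (1 - a l * ?B s))"
    if a: "\<And>l. l < k \<Longrightarrow> 0 \<le> a l \<and> a l * ?B s < 1"
      and eq: "barrier (F s) s (\<lambda>r. of_real (?B r)) = of_real (\<Sum>l<k. a l / (1 - a l * ?B s))"
    for a :: "nat \<Rightarrow> real"
  proof -
    have "Re (of_real (\<Sum>l<k. a l / (1 - a l * ?B s))) \<le> \<phi>"
      using bar[of s] s unfolding eq by simp
    then have "(\<Sum>l<k. a l / (1 - a l * \<beta>)) \<le> \<phi>" by simp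
    then show ?thesis using step(2,3)[of a] a by simp
  qed
  note contr = F.contraction_step[OF separately_poly_F F_contraction[OF s] F_dep \<open>0 < \<tau>\<close> cond]
  have "stable_poly k (F (Suc s)) (\<lambda>r. if r < Suc s then \<tau> else \<beta>)"
    using contr(1) unfolding upd by blast
  moreover have "Re (barrier (F (Suc s)) j (\<lambda>r. of_real (if r < Suc s then \<tau> else \<beta>))) \<le> \<phi>"
    if "Suc s \<le> j" "j < m" for j
  proof -
    have "Re (barrier (F (Suc s)) j (\<lambda>r. of_real ((?B(s := \<tau>)) r))) \<le> Re (barrier (F s) j (\<lambda>r. of_real (?B r)))"
      using that by (intro contr(2)) auto
    also have "\<dots> \<le> \<phi>" using that by (intro bar) auto
    finally show ?thesis unfolding upd .
  qed
  ultimately show ?case by blast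
qed

end

section \<open>The characteristic polynomial and its largest root\<close>

lemma bij_betw_pick:
  assumes "finite I"
  shows "bij_betw (pick I) {0..<card I} I"
proof -
  have "inj_on (pick I) {0..<card I}"
    by (rule inj_onI) (metis atLeastLessThan_iff card_pick_le)
  moreover have "pick I ` {0..<card I} \<subseteq> I" using pick_in_set_le by auto
  ultimately show ?thesis
    using assms by (simp add: bij_betw_def card_image card_subset_eq)
qed

text \<open>A permutation moving an index outside \<open>I\<close> meets a zero of that unit row, so
  only permutations of \<open>I\<close> survive in the Leibniz sum; \<open>pick I\<close> renumbers
  them and keeps their signs.\<close>

lemma det_unit_rows:
  fixes M :: "nat \<Rightarrow> nat \<Rightarrow> complex"
  assumes I: "I \<subseteq> {0..<N}"
    and unit: "\<And>r c. r < N \<Longrightarrow> r \<notin> I \<Longrightarrow> M r c = (if r = c then 1 else 0)"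
  shows "det (mat N N (\<lambda>(r, c). M r c)) = det (mat (card I) (card I) (\<lambda>(i, j). M (pick I i) (pick I j)))"
proof -
  let ?n = "card I"
  have fin: "finite I" using I finite_subset by blast
  note bij = bij_betw_pick[OF fin]
  define \<Phi> where "\<Phi> = map_permutation {0..<?n} (pick I)"
  have \<Phi>: "bij_betw \<Phi> {p. p permutes {0..<?n}} {p. p permutes I}"
  proof -
    have "\<Phi> = (\<lambda>\<pi> x. if x \<in> I then pick I (\<pi> (inv_into {0..<?n} (pick I) x)) else x)"
      using bij by (auto simp: \<Phi>_def map_permutation_def restrict_id_def bij_betw_def fun_eq_iff)
    then show ?thesis using bij_betw_permutations[OF bij] by simp
  qed
  have \<Phi>_pick: "\<Phi> p (pick I i) = pick I (p i)" if "i < ?n" for p i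
    using bij that by (auto simp: \<Phi>_def map_permutation_def restrict_id_def bij_betw_def)
  have "det (mat N N (\<lambda>(r, c). M r c)) =
    (\<Sum>p | p permutes {0..<N}. signof p * (\<Prod>r = 0..<N. mat N N (\<lambda>(r, c). M r c) $$ (r, p r)))"
    by (rule det_def') simp
  also have "\<dots> = (\<Sum>p | p permutes {0..<N}. signof p * (\<Prod>r = 0..<N. M r (p r)))"
  proof (intro sum.cong prod.cong arg_cong2[where f = "(*)"] refl)
    fix p r assume "p \<in> {p. p permutes {0..<N}}" "r \<in> {0..<N}"
    then show "mat N N (\<lambda>(r, c). M r c) $$ (r, p r) = M r (p r)"
      using permutes_in_image[of p "{0..<N}" r] by simp
  qed
  also have "\<dots> = (\<Sum>p | p permutes I. signof p * (\<Prod>r = 0..<N. M r (p r)))"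
  proof (rule sum.mono_neutral_right)
    show "finite {p. p permutes {0..<N}}" by (simp add: finite_permutations)
    show "{p. p permutes I} \<subseteq> {p. p permutes {0..<N}}" using I permutes_subset by blast
    show "\<forall>p\<in>{p. p permutes {0..<N}} - {p. p permutes I}. signof p * (\<Prod>r = 0..<N. M r (p r)) = 0"
    proof
      fix p assume p: "p \<in> {p. p permutes {0..<N}} - {p. p permutes I}"
      have "\<not> (\<forall>r\<in>{0..<N} - I. p r = r)"
      proof
        assume "\<forall>r\<in>{0..<N} - I. p r = r"
        then have "p permutes I" using p by (intro permutes_superset[of p "{0..<N}" I]) auto
        then show False using p by simp
      qed
      then obtain r where r: "r < N" "r \<notin> I" "p r \<noteq> r" by auto
      then have "M r (p r) = 0" using unit by simp
      then have "(\<Prod>r = 0..<N. M r (p r)) = 0" using r by (intro prod_zero) auto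
      then show "signof p * (\<Prod>r = 0..<N. M r (p r)) = 0" by simp
    qed
  qed
  also have "\<dots> = (\<Sum>p | p permutes I. signof p * (\<Prod>r\<in>I. M r (p r)))"
  proof (intro sum.cong refl arg_cong2[where f = "(*)"] prod.mono_neutral_right)
    fix p assume "p \<in> {p. p permutes I}"
    then show "\<forall>r\<in>{0..<N} - I. M r (p r) = 1" using unit by (auto simp: permutes_not_in)
  qed (use I in auto)
  also have "\<dots> = (\<Sum>p | p permutes {0..<?n}. signof (\<Phi> p) * (\<Prod>r\<in>I. M r (\<Phi> p r)))"
    by (rule sum.reindex_bij_betw[OF \<Phi>, symmetric])
  also have "\<dots> = (\<Sum>p | p permutes {0..<?n}. signof p * (\<Prod>i = 0..<?n. mat ?n ?n (\<lambda>(i, j). M (pick I i) (pick I j)) $$ (i, p i)))"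
  proof (rule sum.cong[OF refl])
    fix p assume "p \<in> {p. p permutes {0..<?n}}"
    then have p: "p permutes {0..<?n}" by simp
    have "sign (\<Phi> p) = sign p"
      unfolding \<Phi>_def using bij p by (intro sign_map_permutation) (auto simp: bij_betw_def)
    moreover have "(\<Prod>r\<in>I. M r (\<Phi> p r)) = (\<Prod>i = 0..<?n. M (pick I i) (\<Phi> p (pick I i)))"
      by (rule prod.reindex_bij_betw[OF bij, symmetric])
    moreover have "\<dots> = (\<Prod>i = 0..<?n. mat ?n ?n (\<lambda>(i, j). M (pick I i) (pick I j)) $$ (i, p i))"
    proof (rule prod.cong[OF refl])
      fix i assume "i \<in> {0..<?n}"
      then show "M (pick I i) (\<Phi> p (pick I i)) = mat ?n ?n (\<lambda>(i, j). M (pick I i) (pick I j)) $$ (i, p i)"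
        using permutes_in_image[OF p, of i] by (simp add: \<Phi>_pick)
    qed
    ultimately show "signof (\<Phi> p) * (\<Prod>r\<in>I. M r (\<Phi> p r)) =
      signof p * (\<Prod>i = 0..<?n. mat ?n ?n (\<lambda>(i, j). M (pick I i) (pick I j)) $$ (i, p i))" by simp
  qed
  also have "\<dots> = det (mat ?n ?n (\<lambda>(i, j). M (pick I i) (pick I j)))"
    by (rule det_def'[symmetric]) simp
  finally show ?thesis .
qed

section \<open>Choice functions, selected rows and ordered partitions\<close>

definition selected_rows :: "nat \<Rightarrow> nat \<Rightarrow> (nat \<Rightarrow> nat) \<Rightarrow> nat set" where
  "selected_rows k m \<sigma> = {r. r < k * m \<and> r div m = \<sigma> (r mod m)}"

lemma card_selected_rows:
  assumes "0 < m" and \<sigma>: "\<sigma> \<in> {..<m} \<rightarrow>\<^sub>E {..<k}"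
  shows "card (selected_rows k m \<sigma>) = m"
proof -
  have "bij_betw (\<lambda>i. i + \<sigma> i * m) {..<m} (selected_rows k m \<sigma>)"
  proof (rule bij_betw_byWitness[where f' = "\<lambda>r. r mod m"])
    show "(\<lambda>i. i + \<sigma> i * m) ` {..<m} \<subseteq> selected_rows k m \<sigma>"
    proof clarsimp
      fix i assume i: "i < m"
      then have "Suc (\<sigma> i) * m \<le> k * m" using \<sigma> by (intro mult_le_mono1) (auto simp: PiE_def Pi_def Suc_le_eq)
      then show "i + \<sigma> i * m \<in> selected_rows k m \<sigma>" using i by (simp add: selected_rows_def)
    qed
    show "\<forall>r\<in>selected_rows k m \<sigma>. r mod m + \<sigma> (r mod m) * m = r"
      by (auto simp: selected_rows_def) (metis mod_div_mult_eq)
    show "\<forall>i\<in>{..<m}. (i + \<sigma> i * m) mod m = i" by simp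
    show "(\<lambda>r. r mod m) ` selected_rows k m \<sigma> \<subseteq> {..<m}" using \<open>0 < m\<close> by auto
  qed
  from bij_betw_same_card[OF this] show ?thesis by simp
qed

text \<open>Unselected rows have weight 0 and are unit rows, which \<open>det_unit_rows\<close>
  deletes. What remains is the determinant of I - B / x for the submatrix B, and x^m clears the
  denominators.\<close>

lemma poly_char_poly_selected:
  fixes A :: "complex mat"
  assumes A: "A \<in> carrier_mat (k * m) (k * m)" and "0 < m" and \<sigma>: "\<sigma> \<in> {..<m} \<rightarrow>\<^sub>E {..<k}" and x: "x \<noteq> 0"
  shows "poly (char_poly (submatrix A (selected_rows k m \<sigma>) (selected_rows k m \<sigma>))) x =
    x ^ m * row_det (k * m) (\<lambda>r c. A $$ (r, c)) (block_weights m m \<sigma> (\<lambda>_. 1 / x))"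
proof -
  let ?I = "selected_rows k m \<sigma>"
  let ?B = "submatrix A ?I ?I"
  have card: "card ?I = m" by (rule card_selected_rows[OF assms(2) \<sigma>])
  have I: "{i. i < k * m \<and> i \<in> ?I} = ?I" by (auto simp: selected_rows_def)
  have B: "?B \<in> carrier_mat m m"
    using A by (intro carrier_matI) (simp_all add: dim_submatrix I card)
  have entry: "?B $$ (i, j) = A $$ (pick ?I i, pick ?I j)" if "i < m" "j < m" for i j
    using that A by (intro submatrix_index) (simp_all add: I card)
  let ?M = "\<lambda>r c. (if r = c then 1 else 0) - block_weights m m \<sigma> (\<lambda>_. 1 / x) r * A $$ (r, c)"
  let ?C = "mat m m (\<lambda>(i, j). ?M (pick ?I i) (pick ?I j))"
  have pick: "pick ?I i \<in> ?I" "pick ?I i = pick ?I j \<longleftrightarrow> i = j" if "i < m" "j < m" for i j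
  proof -
    have "finite ?I" by (simp add: selected_rows_def)
    note bij = bij_betw_pick[OF this, unfolded card]
    show "pick ?I i \<in> ?I" using bij that by (auto simp: bij_betw_def)
    show "pick ?I i = pick ?I j \<longleftrightarrow> i = j" using bij that by (auto simp: bij_betw_def inj_on_def)
  qed
  have "det (mat (k * m) (k * m) (\<lambda>(r, c). ?M r c)) =
    det (mat (card ?I) (card ?I) (\<lambda>(i, j). ?M (pick ?I i) (pick ?I j)))"
  proof (rule det_unit_rows)
    show "?I \<subseteq> {0..<k * m}" by (auto simp: selected_rows_def)
    show "?M r c = (if r = c then 1 else 0)" if "r < k * m" "r \<notin> ?I" for r c
      using that \<open>0 < m\<close> by (simp add: block_weights_def selected_rows_def)
  qed
  then have "row_det (k * m) (\<lambda>r c. A $$ (r, c)) (block_weights m m \<sigma> (\<lambda>_. 1 / x)) = det ?C"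
    by (simp only: row_det_def card)
  moreover have "- char_matrix ?B x = x \<cdot>\<^sub>m ?C"
  proof (rule eq_matI)
    fix i j assume "i < dim_row (x \<cdot>\<^sub>m ?C)" "j < dim_col (x \<cdot>\<^sub>m ?C)"
    then have ij: "i < m" "j < m" by auto
    have "block_weights m m \<sigma> (\<lambda>_. 1 / x) (pick ?I i) = 1 / x"
      using pick(1)[OF ij] by (simp add: block_weights_def selected_rows_def)
    then show "(- char_matrix ?B x) $$ (i, j) = (x \<cdot>\<^sub>m ?C) $$ (i, j)"
      using B ij x by (simp add: char_matrix_def entry pick(2) algebra_simps)
  qed (use B in \<open>auto simp: char_matrix_def\<close>)
  ultimately show ?thesis
    unfolding char_poly_matrix[OF B] by simp
qed

text \<open>An ordered partition is the family of fibres of the map sending \<open>i\<close> to the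
  index of the part containing it; restricting to \<open>{..<k}\<close> matches the extensional
  encoding of tuples.\<close>

lemma bij_betw_ordered_partitions:
  "bij_betw (\<lambda>\<sigma>. \<lambda>j\<in>{..<k}. {i. i < m \<and> \<sigma> i = j}) ({..<m} \<rightarrow>\<^sub>E {..<k}) (ordered_partitions k m)"
  unfolding bij_betw_def
proof (intro conjI equalityI subsetI)
  let ?\<Psi> = "\<lambda>\<sigma>. \<lambda>j\<in>{..<k}. {i. i < m \<and> \<sigma> i = (j::nat)}"
  show "inj_on ?\<Psi> ({..<m} \<rightarrow>\<^sub>E {..<k})"
  proof (rule inj_onI)
    fix \<sigma> \<rho> assume \<sigma>: "\<sigma> \<in> {..<m} \<rightarrow>\<^sub>E {..<k}" and \<rho>: "\<rho> \<in> {..<m} \<rightarrow>\<^sub>E {..<k}" and eq: "?\<Psi> \<sigma> = ?\<Psi> \<rho>"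
    show "\<sigma> = \<rho>"
    proof (rule PiE_ext[OF \<sigma> \<rho>])
      fix i assume i: "i \<in> {..<m}"
      then have "\<sigma> i < k" using \<sigma> by auto
      then have "i \<in> ?\<Psi> \<sigma> (\<sigma> i)" using i by simp
      then have "i \<in> ?\<Psi> \<rho> (\<sigma> i)" unfolding eq .
      then show "\<sigma> i = \<rho> i" using \<open>\<sigma> i < k\<close> by simp
    qed
  qed
  fix S
  show "S \<in> ordered_partitions k m" if image: "S \<in> ?\<Psi> ` ({..<m} \<rightarrow>\<^sub>E {..<k})"
  proof -
    obtain \<sigma> where \<sigma>: "\<sigma> \<in> {..<m} \<rightarrow>\<^sub>E {..<k}" and S: "S = ?\<Psi> \<sigma>" using image by blast
    have "S \<in> {..<k} \<rightarrow>\<^sub>E Pow {..<m}" unfolding S by auto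
    moreover have "disjoint_family_on S {..<k}" unfolding S by (auto simp: disjoint_family_on_def)
    moreover have "(\<Union>j<k. S j) = {..<m}" using PiE_mem[OF \<sigma>] unfolding S by auto
    ultimately show ?thesis by (simp add: ordered_partitions_def)
  qed
  assume S: "S \<in> ordered_partitions k m"
  then have "\<forall>i\<in>{..<m}. \<exists>j<k. i \<in> S j" by (auto simp: ordered_partitions_def)
  then obtain \<sigma> where \<sigma>: "\<And>i. i < m \<Longrightarrow> \<sigma> i < k \<and> i \<in> S (\<sigma> i)" by (metis lessThan_iff)
  let ?\<sigma> = "\<lambda>i\<in>{..<m}. \<sigma> i"
  have "S = ?\<Psi> ?\<sigma>"
  proof
    fix j
    show "S j = ?\<Psi> ?\<sigma> j"
    proof (cases "j < k")
      case True
      have "i \<in> S j \<longleftrightarrow> i < m \<and> \<sigma> i = j" for i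
      proof
        assume i: "i \<in> S j"
        then have "i < m" using S True by (auto simp: ordered_partitions_def)
        moreover have "\<sigma> i = j"
        proof (rule ccontr)
          assume "\<sigma> i \<noteq> j"
          then have "S (\<sigma> i) \<inter> S j = {}"
            using S True \<sigma>[OF \<open>i < m\<close>] by (auto simp: ordered_partitions_def disjoint_family_on_def)
          then show False using i \<sigma>[OF \<open>i < m\<close>] by blast
        qed
        ultimately show "i < m \<and> \<sigma> i = j" ..
      qed (use \<sigma> in auto)
      then show ?thesis using True by auto
    next
      case False
      then show ?thesis using S by (auto simp: ordered_partitions_def)
    qed
  qed
  moreover have "?\<sigma> \<in> {..<m} \<rightarrow>\<^sub>E {..<k}" using \<sigma> by auto
  ultimately show "S \<in> ?\<Psi> ` ({..<m} \<rightarrow>\<^sub>E {..<k})" by blast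
qed

lemma shifted_union_fibers:
  assumes "0 < m"
  shows "shifted_union k m (\<lambda>j\<in>{..<k}. {i. i < m \<and> \<sigma> i = j}) = selected_rows k m \<sigma>"
proof (intro equalityI subsetI)
  fix r assume "r \<in> shifted_union k m (\<lambda>j\<in>{..<k}. {i. i < m \<and> \<sigma> i = j})"
  then obtain i j where "j < k" "i < m" "\<sigma> i = j" "r = i + j * m" by (auto simp: shifted_union_def)
  moreover from this have "Suc j * m \<le> k * m" by (intro mult_le_mono1) simp
  ultimately show "r \<in> selected_rows k m \<sigma>" by (simp add: selected_rows_def)
next
  fix r assume r: "r \<in> selected_rows k m \<sigma>"
  have "r < k * m" using r by (simp add: selected_rows_def)
  then have "r div m < k" by (rule less_mult_imp_div_less)
  moreover have "r = r mod m + (r div m) * m" by simp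
  moreover have "r mod m < m" using assms by simp
  moreover have "\<sigma> (r mod m) = r div m" using r by (simp add: selected_rows_def)
  ultimately show "r \<in> shifted_union k m (\<lambda>j\<in>{..<k}. {i. i < m \<and> \<sigma> i = j})"
    unfolding shifted_union_def by (intro UN_I[of "r div m"] image_eqI[of _ _ "r mod m"]) auto
qed

lemma km_char_poly_eq:
  assumes "0 < m"
  shows "km_char_poly k m A = smult (1 / of_nat k ^ m)
    (\<Sum>\<sigma>\<in>{..<m} \<rightarrow>\<^sub>E {..<k}. char_poly (submatrix A (selected_rows k m \<sigma>) (selected_rows k m \<sigma>)))"
  unfolding km_char_poly_def partition_submatrix_def
  using sum.reindex_bij_betw[OF bij_betw_ordered_partitions[where k = k and m = m],
      of "\<lambda>S. char_poly (submatrix A (shifted_union k m S) (shifted_union k m S))"]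
  by (simp add: shifted_union_fibers[OF assms])

lemma poly_km_char_poly:
  assumes "A \<in> carrier_mat (k * m) (k * m)" and "0 < m" and "x \<noteq> 0"
  shows "poly (km_char_poly k m A) x = x ^ m * block_average k m (\<lambda>r c. A $$ (r, c)) m (\<lambda>_. 1 / x)"
  unfolding km_char_poly_eq[OF assms(2)] block_average_def
  by (simp add: poly_sum poly_char_poly_selected[OF assms(1,2) _ assms(3)] sum_distrib_left sum_divide_distrib)

text \<open>A mean of \<open>k ^ m\<close> monic polynomials of degree \<open>m\<close>. The theorem
  uses this to see that the polynomial has a root and only finitely many, so that the
  \<open>Max\<close> in \<open>maxroot\<close> is attained.\<close>

lemma coeff_km_char_poly:
  assumes A: "A \<in> carrier_mat (k * m) (k * m)" and "0 < m" "0 < k"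
  shows "coeff (km_char_poly k m A) m = 1"
proof -
  have "coeff (char_poly (submatrix A (selected_rows k m \<sigma>) (selected_rows k m \<sigma>))) m = 1"
    if \<sigma>: "\<sigma> \<in> {..<m} \<rightarrow>\<^sub>E {..<k}" for \<sigma>
  proof -
    have "{i. i < k * m \<and> i \<in> selected_rows k m \<sigma>} = selected_rows k m \<sigma>"
      by (auto simp: selected_rows_def)
    then have "submatrix A (selected_rows k m \<sigma>) (selected_rows k m \<sigma>) \<in> carrier_mat m m"
      using A card_selected_rows[OF \<open>0 < m\<close> \<sigma>] by (intro carrier_matI) (simp_all add: dim_submatrix)
    then show ?thesis using degree_monic_char_poly by blast
  qed
  then show ?thesis
    unfolding km_char_poly_eq[OF \<open>0 < m\<close>] using \<open>0 < k\<close>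
    by (simp add: coeff_sum card_PiE)
qed

text \<open>With a = \<epsilon> / K and s^2 = \<epsilon> (1 - a) the bound reads 1 + u + \<epsilon>
  + s^2 / (u + a). It is optimised at u = s - a, where it equals 1 - a + \<epsilon> + 2 s, the
  square in the conclusion. The upper bound on \<epsilon> yields a \<le> s, so this u is
  nonnegative.\<close>

lemma bound_optimization:
  fixes Y K \<epsilon> :: real
  assumes K: "1 \<le> K" and \<epsilon>: "0 \<le> \<epsilon>" "\<epsilon> \<le> K\<^sup>2 / (K + 1)"
    and Y: "\<And>u. 0 < u \<Longrightarrow> Y \<le> 1 + u + \<epsilon> * K * (1 + u) / (u * K + \<epsilon>)"
  shows "Y \<le> (sqrt (1 - \<epsilon> / K) + sqrt \<epsilon>)\<^sup>2"
proof -
  define a where "a = \<epsilon> / K"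
  have a0: "0 \<le> a" using \<epsilon> K by (simp add: a_def)
  have \<epsilon>_a: "\<epsilon> = a * K" using K by (simp add: a_def)
  have "a * K \<le> K / (K + 1) * K" using \<epsilon>(2) by (simp add: \<epsilon>_a power2_eq_square)
  then have a_le: "a \<le> K / (K + 1)" using K by (simp only: mult_le_cancel_right_pos)
  have a1: "a < 1" using a_le K by (smt (verit) divide_less_eq_1)
  define s where "s = sqrt (\<epsilon> * (1 - a))"
  have s2: "s * s = \<epsilon> * (1 - a)" using \<epsilon> a1 by (simp add: s_def)
  have "a * (K + 1) \<le> K" using a_le K by (simp add: field_simps)
  then have "a \<le> K * (1 - a)" by (simp add: algebra_simps)
  then have "a * a \<le> a * (K * (1 - a))" using a0 by (rule mult_left_mono)
  also have "\<dots> = \<epsilon> * (1 - a)" by (simp add: \<epsilon>_a)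
  finally have "a \<le> s" unfolding s_def using a0 by (intro real_le_rsqrt) (simp add: power2_eq_square)
  have Y': "Y \<le> 1 + u + \<epsilon> + s * s / (u + a)" if u: "0 < u" for u
  proof -
    have "\<epsilon> * K * (1 + u) / (u * K + \<epsilon>) = \<epsilon> * (1 + u) / (u + a)"
    proof -
      have "u * K + \<epsilon> = K * (u + a)" by (simp add: \<epsilon>_a algebra_simps)
      then show ?thesis using K by simp
    qed
    also have "\<dots> = \<epsilon> + s * s / (u + a)"
      unfolding s2 using u a0 by (simp add: divide_simps) (simp add: algebra_simps)
    finally show ?thesis using Y[OF u] by simp
  qed
  have "(sqrt (1 - \<epsilon> / K) + sqrt \<epsilon>)\<^sup>2 = 1 - a + \<epsilon> + 2 * s"
    using \<epsilon> a1 by (simp add: power2_sum s_def real_sqrt_mult a_def)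
  moreover have "Y \<le> 1 - a + \<epsilon> + 2 * s"
  proof (cases "a < s")
    case True
    then have "s * s / (s - a + a) = s" using a0 by simp
    then show ?thesis using Y'[of "s - a"] True by simp
  next
    case False
    then have s: "s = a" using \<open>a \<le> s\<close> by simp
    \<comment> \<open>Here the optimum is u = 0, which is not admissible and is approached through
      \<open>e > 0\<close>.\<close>
    have "Y \<le> 1 + \<epsilon> + a + e" if e: "0 < e" for e
    proof -
      have "a * a / (e + a) \<le> a"
        using a0 e by (simp add: divide_le_eq mult_left_mono)
      then show ?thesis using Y'[OF e] s by simp
    qed
    then have "Y \<le> 1 + \<epsilon> + a" by (rule field_le_epsilon)
    then show ?thesis using s by simp
  qed
  ultimately show ?thesis by simp
qed

section \<open>From matrices to entry functions, and the final bound\<close>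

lemma quadratic_form_vec:
  fixes M :: "complex mat"
  assumes "M \<in> carrier_mat n n"
  shows "(M *\<^sub>v vec n x) \<bullet>c vec n x = (\<Sum>r<n. (\<Sum>c<n. M $$ (r, c) * x c) * cnj (x r))"
  using assms by (auto simp: scalar_prod_def atLeast0LessThan intro!: sum.cong)

lemma hermitian_contraction_mat:
  assumes A: "A \<in> carrier_mat n n" and "hermitian_mat A"
    and psd: "0\<^sub>m n n \<preceq>\<^sub>L A" and le: "A \<preceq>\<^sub>L 1\<^sub>m n"
  shows "hermitian_contraction n (\<lambda>r c. A $$ (r, c))"
proof
  show "A $$ (r, c) = cnj (A $$ (c, r))" if "r < n" "c < n" for r c
  proof -
    have "A $$ (r, c) = mat_adjoint A $$ (r, c)" using assms(2) by (simp add: hermitian_mat_def)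
    also have "\<dots> = cnj (A $$ (c, r))" using A that by (simp add: mat_adjoint_def mat_of_rows_def)
    finally show ?thesis .
  qed
  fix x :: "nat \<Rightarrow> complex"
  have "A - 0\<^sub>m n n = A" using A by auto
  then have "psd_mat A" using psd by (simp add: loewner_le_def)
  then have "0 \<le> (A *\<^sub>v vec n x) \<bullet>c vec n x" using A by (simp add: psd_mat_def)
  then show "0 \<le> Re (\<Sum>r<n. (\<Sum>c<n. A $$ (r, c) * x c) * cnj (x r))"
    unfolding quadratic_form_vec[OF A] by (simp add: less_eq_complex_def)
  have B: "1\<^sub>m n - A \<in> carrier_mat n n" using A by auto
  have "psd_mat (1\<^sub>m n - A)" using le by (simp add: loewner_le_def)
  then have "0 \<le> ((1\<^sub>m n - A) *\<^sub>v vec n x) \<bullet>c vec n x" using A by (simp add: psd_mat_def)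
  moreover have "((1\<^sub>m n - A) *\<^sub>v vec n x) \<bullet>c vec n x =
    (\<Sum>r<n. of_real ((norm (x r))\<^sup>2)) - (\<Sum>r<n. (\<Sum>c<n. A $$ (r, c) * x c) * cnj (x r))"
    unfolding quadratic_form_vec[OF B] sum_subtractf[symmetric]
  proof (rule sum.cong[OF refl])
    fix r assume r: "r \<in> {..<n}"
    have "(\<Sum>c<n. (1\<^sub>m n - A) $$ (r, c) * x c) = (\<Sum>c<n. (if r = c then x c else 0) - A $$ (r, c) * x c)"
      using A r by (intro sum.cong) (auto simp: algebra_simps)
    also have "\<dots> = x r - (\<Sum>c<n. A $$ (r, c) * x c)" using r by (simp add: sum_subtractf)
    finally show "(\<Sum>c<n. (1\<^sub>m n - A) $$ (r, c) * x c) * cnj (x r) =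
      of_real ((norm (x r))\<^sup>2) - (\<Sum>c<n. A $$ (r, c) * x c) * cnj (x r)"
      by (simp only: complex_norm_square left_diff_distrib)
  qed
  ultimately show "Re (\<Sum>r<n. (\<Sum>c<n. A $$ (r, c) * x c) * cnj (x r)) \<le> (\<Sum>r<n. (norm (x r))\<^sup>2)"
    by (simp add: less_eq_complex_def del: of_real_power)
qed

theorem theorem4p1:
  fixes k m :: nat and A :: "complex mat" and \<epsilon> :: real
  assumes "k \<ge> 2" and "m \<ge> 1"
    and "A \<in> carrier_mat (k * m) (k * m)"
    and "hermitian_mat A"
    and "0\<^sub>m (k * m) (k * m) \<preceq>\<^sub>L A" and "A \<preceq>\<^sub>L 1\<^sub>m (k * m)"
    and "\<epsilon> = Max ((\<lambda>i. \<Sum>j<k. Re (A $$ (i + j * m, i + j * m))) ` {..<m})"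
    and "\<epsilon> \<le> (real k - 1)^2 / real k"
  shows "maxroot (km_char_poly k m A) \<le> 1 / real k * (sqrt (1 - \<epsilon> / (real k - 1)) + sqrt \<epsilon>)^2"
proof -
  have m: "0 < m" and k: "0 < k" using assms(1,2) by auto
  interpret hermitian_contraction "k * m" "\<lambda>r c. A $$ (r, c)"
    by (rule hermitian_contraction_mat[OF assms(3-6)])
  interpret hermitian_block_contraction k m "\<lambda>r c. A $$ (r, c)"
    by unfold_locales (use assms(1) m in auto)
  let ?p = "km_char_poly k m A"
  let ?F = "block_average k m (\<lambda>r c. A $$ (r, c)) m"
  have \<epsilon>_ge: "(\<Sum>j<k. Re (A $$ (i + j * m, i + j * m))) \<le> \<epsilon>" if "i < m" for i
    unfolding assms(7) using that by (intro Max_ge) auto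
  have "0 \<le> (\<Sum>j<k. Re (A $$ (0 + j * m, 0 + j * m)))"
  proof (intro sum_nonneg diag_nonneg)
    fix j assume "j \<in> {..<k}"
    then show "0 + j * m < k * m" using m by simp
  qed
  also have "\<dots> \<le> \<epsilon>" by (rule \<epsilon>_ge[OF m])
  finally have \<epsilon>0: "0 \<le> \<epsilon>" .
  define K where "K = real k - 1"
  have K: "1 \<le> K" using assms(1) by (simp add: K_def)
  note stable_F' = stable_F[of _ \<epsilon> _ _ m, OF _ _ \<epsilon>_ge refl refl order_refl]
  have p: "poly ?p x = x ^ m * ?F (\<lambda>_. 1 / x)" if "x \<noteq> 0" for x
    by (rule poly_km_char_poly[OF assms(3) m that])
  have co: "coeff ?p m = 1" by (rule coeff_km_char_poly[OF assms(3) m k])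
  then have "?p \<noteq> 0" by auto
  have "m \<le> degree ?p" using co by (intro le_degree) simp
  then have "\<not> constant (poly ?p)" using m by (simp add: constant_degree)
  then obtain z where z: "poly ?p z = 0" using fundamental_theorem_of_algebra by blast
  have real_roots: "Im z = 0" if z: "poly ?p z = 0" for z
  proof (rule ccontr)
    assume im: "Im z \<noteq> 0"
    then have z0: "z \<noteq> 0" by auto
    \<comment> \<open>Only stability is wanted here, and any \<beta> strictly between 0 and 1
      provides it.\<close>
    have "0 < (1 / 2 :: real)" "(1 / 2 :: real) < 1" by simp_all
    from stable_F'[OF this, THEN conjunct1] obtain B where "stable_poly k ?F B" by blast
    then interpret S: stable_poly k ?F B .
    have F0: "?F (\<lambda>_. 1 / z) = 0" using z p[OF z0] z0 by simp
    then have F0': "?F (\<lambda>_. cnj (1 / z)) = 0" using S.cnj_f[of "\<lambda>_. 1 / z"] by simp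
    show False
    proof (cases "Im z < 0")
      case True
      then have "0 < Im (1 / z)" by (simp add: Im_divide divide_neg_pos sum_power2_gt_zero_iff)
      then show False using S.stable[of "\<lambda>_. 1 / z"] F0 by simp
    next
      case False
      then have "0 < Im (cnj (1 / z))" using im by (simp add: Im_divide sum_power2_gt_zero_iff)
      then show False using S.stable[of "\<lambda>_. cnj (1 / z)"] F0' by simp
    qed
  qed
  let ?X = "{x. poly ?p (complex_of_real x) = 0}"
  have "?X \<noteq> {}"
  proof -
    have "z = of_real (Re z)" using real_roots[OF z] by (simp add: complex_eq_iff)
    then show ?thesis using z by (metis (mono_tags, lifting) empty_iff mem_Collect_eq)
  qed
  moreover have "finite ?X"
  proof -
    have "finite (of_real -` {z. poly ?p z = 0} :: real set)"
      using poly_roots_finite[OF \<open>?p \<noteq> 0\<close>] by (intro finite_vimageI) (auto simp: inj_on_def)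
    then show ?thesis by (simp add: vimage_def)
  qed
  ultimately have M: "maxroot ?p \<in> ?X" unfolding maxroot_def by (rule Max_in[rotated])
  define Y where "Y = real k * maxroot ?p"
  have "Y \<le> 1 + u + \<epsilon> * K * (1 + u) / (u * K + \<epsilon>)" if u: "0 < u" for u
  proof -
    \<comment> \<open>Parametrising (0, 1) by positive \<open>u\<close> turns k / \<tau> into the
      expression minimised in \<open>bound_optimization\<close>.\<close>
    define \<beta> where "\<beta> = 1 / (1 + u)"
    have \<beta>: "0 < \<beta>" "\<beta> < 1" using u by (simp_all add: \<beta>_def)
    define \<phi> where "\<phi> = \<epsilon> / (1 - \<beta>)"
    define \<tau> where "\<tau> = k / (1 / \<beta> + \<phi> * (real k - 1) / (real k - 1 + \<beta> * \<phi>))"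
    have \<phi>: "\<phi> = \<epsilon> * (1 + u) / u" using u by (simp add: \<phi>_def \<beta>_def field_simps)
    have \<beta>\<phi>: "\<beta> * \<phi> = \<epsilon> / u" using u by (simp add: \<phi> \<beta>_def)
    have den: "1 / \<beta> + \<phi> * K / (K + \<beta> * \<phi>) = 1 + u + \<epsilon> * K * (1 + u) / (u * K + \<epsilon>)"
    proof -
      have "K + \<epsilon> / u = (u * K + \<epsilon>) / u" using u by (simp add: field_simps)
      then have "\<phi> * K / (K + \<beta> * \<phi>) = \<phi> * K / ((u * K + \<epsilon>) / u)" by (simp only: \<beta>\<phi>)
      also have "\<dots> = \<epsilon> * K * (1 + u) / (u * K + \<epsilon>)" unfolding \<phi> using u by (simp add: mult_ac)
      finally show ?thesis by (simp add: \<beta>_def)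
    qed
    define D where "D = 1 + u + \<epsilon> * K * (1 + u) / (u * K + \<epsilon>)"
    have "0 < D" unfolding D_def using u \<epsilon>0 K by (intro add_pos_nonneg) auto
    have \<tau>: "\<tau> = k / D" unfolding \<tau>_def D_def using den by (simp add: K_def)
    interpret S: stable_poly k ?F "\<lambda>r. if r < m then \<tau> else \<beta>"
      unfolding \<tau>_def \<phi>_def by (rule stable_F'[OF \<beta>, THEN conjunct1])
    show ?thesis
    proof (rule ccontr)
      assume "\<not> ?thesis"
      then have gt: "D < k * maxroot ?p" by (simp add: Y_def D_def)
      let ?x = "maxroot ?p"
      have x: "0 < ?x" using gt \<open>0 < D\<close> k by (smt (verit) of_nat_0_less_iff zero_less_mult_pos)
      have "1 / ?x \<le> \<tau>" unfolding \<tau> using gt x \<open>0 < D\<close> by (simp add: field_simps)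
      \<comment> \<open>Coordinates from \<open>m\<close> on are set to 0 to stay below \<beta>;
        \<open>F_dep\<close> then passes to the constant point.\<close>
      then have "?F (\<lambda>r. of_real (if r < m then 1 / ?x else 0)) \<noteq> 0"
        using \<beta> by (intro S.nonzero) auto
      moreover have "?F (\<lambda>r. of_real (if r < m then 1 / ?x else 0)) = ?F (\<lambda>_. 1 / of_real ?x)"
        by (rule F_dep) simp
      ultimately have "poly ?p (of_real ?x) \<noteq> 0" using x by (subst p) auto
      then show False using M by simp
    qed
  qed
  then have "Y \<le> (sqrt (1 - \<epsilon> / K) + sqrt \<epsilon>)\<^sup>2"
    using K \<epsilon>0 assms(8) by (intro bound_optimization) (auto simp: K_def)
  then show ?thesis using k by (simp add: Y_def K_def field_simps)
qed

end
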